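(* Let $(H,A,C)$ be a Doi Hom-Hopf datum, with $(H,\alpha)$, $(A,\beta)$, $(C,\gamma)$ the underlying objects. The forgetful functor $F:\widetilde{\mathscr{H}}(\mathscr{M}_k)(H)^{C}_{A}\rightarrow \widetilde{\mathscr{H}}(\mathscr{M}_k)_{A}$ (forgetting the $(C,\gamma)$-coaction) has a right adjoint $G:\widetilde{\mathscr{H}}(\mathscr{M}_k)_{A}\rightarrow \widetilde{\mathscr{H}}(\mathscr{M}_k)(H)^{C}_{A}$. On an object $(M,\mu)$, $G$ is defined by $G(M)=M\otimes C$ (with automorphism $\mu\otimes\gamma$), with structure maps $$(m\otimes c)\cdot a = m\cdot a_{[0]}\otimes c\cdot a_{[1]},\qquad \rho_{G(M)}(m\otimes c)=(\mu^{-1}(m)\otimes c_{(1)})\otimes\gamma(c_{(2)}),$$ for all $a\in A$, $m\in M$, $c\in C$.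
   Context: Let $k$ be a commutative ring, $\mathscr{M}_k$ the category of $k$-modules, $\otimes=\otimes_k$. The category $\widetilde{\mathscr{H}}(\mathscr{M}_k)$ has as objects pairs $(M,\mu)$ with $M$ a $k$-module and $\mu$ a $k$-linear automorphism of $M$; a morphism $f:(M,\mu)\to(N,\nu)$ is a $k$-linear map with $\nu f=f\mu$. Put $(M,\mu)\otimes(N,\nu)=(M\otimes N,\mu\otimes\nu)$. Sumless Sweedler notation is used. A monoidal Hom-algebra is an object $(A,\beta)$ with a $k$-linear multiplication $A\otimes A\to A$ and $1_A\in A$ such that $\beta(ab)=\beta(a)\beta(b)$, $\beta(1_A)=1_A$, $\beta(a)(bc)=(ab)\beta(c)$, $a1_A=1_Aa=\beta(a)$. A monoidal Hom-coalgebra is an object $(C,\gamma)$ with $k$-linear maps $\Delta:C\to C\otimes C$, $\Delta(c)=c_{(1)}\otimes c_{(2)}$, and $\varepsilon:C\to k$ such that $\Delta(\gamma(c))=\gamma(c_{(1)})\otimes\gamma(c_{(2)})$, $\varepsilon(\gamma(c))=\varepsilon(c)$, $\gamma^{-1}(c_{(1)})\otimes c_{(2)(1)}\otimes c_{(2)(2)}=c_{(1)(1)}\otimes c_{(1)(2)}\otimes\gamma^{-1}(c_{(2)})$, $\varepsilon(c_{(1)})c_{(2)}=\varepsilon(c_{(2)})c_{(1)}=\gamma^{-1}(c)$. A monoidal Hom-bialgebra $(H,\alpha)$ is both a monoidal Hom-algebra and a monoidal Hom-coalgebra (with the same $\alpha$) with $\Delta(ab)=a_{(1)}b_{(1)}\otimes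 a_{(2)}b_{(2)}$, $\Delta(1_H)=1_H\otimes1_H$, $\varepsilon(ab)=\varepsilon(a)\varepsilon(b)$, $\varepsilon(1_H)=1$. It is a monoidal Hom-Hopf algebra if there is a $k$-linear $S:H\to H$ with $S\alpha=\alpha S$ and $S(h_{(1)})h_{(2)}=h_{(1)}S(h_{(2)})=\varepsilon(h)1_H$. A right $(A,\beta)$-Hom-module is an object $(M,\mu)$ with a $k$-linear map $M\otimes A\to M$, $m\otimes a\mapsto m\cdot a$, such that $\mu(m\cdot a)=\mu(m)\cdot\beta(a)$, $(m\cdot a)\cdot\beta(b)=\mu(m)\cdot(ab)$, $m\cdot1_A=\mu(m)$. Together with the $A$-linear morphisms of $\widetilde{\mathscr{H}}(\mathscr{M}_k)$ these form the category $\widetilde{\mathscr{H}}(\mathscr{M}_k)_A$. A right $(C,\gamma)$-Hom-comodule is an object $(M,\mu)$ with a $k$-linear map $\rho_M:M\to M\otimes C$, $\rho_M(m)=m_{[0]}\otimes m_{[1]}$, such that $\rho_M(\mu(m))=\mu(m_{[0]})\otimes\gamma(m_{[1]})$, $m_{[0][0]}\otimes m_{[0][1]}\otimes\gamma^{-1}(m_{[1]})=\mu^{-1}(m_{[0]})\otimes\Delta(m_{[1]})$, $m_{[0]}\varepsilon(m_{[1]})=\mu^{-1}(m)$. Morphisms are the colinear morphisms of $\widetilde{\mathscr{H}}(\mathscr{M}_k)$. A right $(H,\alpha)$-Hom-comodule algebra is a monoidal Hom-algebra $(A,\beta)$ that is a right $(H,\alpha)$-Hom-comodule via $\rho_A(a)=a_{[0]}\otimes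 a_{[1]}\in A\otimes H$ with $\rho_A(ab)=a_{[0]}b_{[0]}\otimes a_{[1]}b_{[1]}$ and $\rho_A(1_A)=1_A\otimes1_H$. A right $(H,\alpha)$-Hom-module coalgebra is a monoidal Hom-coalgebra $(C,\gamma)$ that is a right $(H,\alpha)$-Hom-module with $\Delta(c\cdot h)=c_{(1)}\cdot h_{(1)}\otimes c_{(2)}\cdot h_{(2)}$ and $\varepsilon(c\cdot h)=\varepsilon(c)\varepsilon(h)$. A Doi Hom-Hopf datum $(H,A,C)$ consists of a monoidal Hom-Hopf algebra $(H,\alpha)$, a right $(H,\alpha)$-Hom-comodule algebra $(A,\beta)$ and a right $(H,\alpha)$-Hom-module coalgebra $(C,\gamma)$. A Doi Hom-Hopf module is an object $(M,\mu)$ that is both a right $(A,\beta)$-Hom-module and a right $(C,\gamma)$-Hom-comodule such that $\rho_M(m\cdot a)=m_{[0]}\cdot a_{[0]}\otimes m_{[1]}\cdot a_{[1]}$ for all $m\in M$, $a\in A$. With maps that are both $A$-linear and $C$-colinear morphisms, they form the category $\widetilde{\mathscr{H}}(\mathscr{M}_k)(H)^{C}_{A}$. *)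

theory Defs
  imports "HOL-Algebra.Module"
begin

section \<open>Modules and tensor products\<close>

text \<open>
  The carriers of all modules are subsets of one type \<open>'u univ\<close>, a universe over an arbitrary
  type of atoms \<open>'u\<close> which is closed under tensor products: a tensor is stored as a list
  \<open>Tensor [(x\<^sub>1, y\<^sub>1), \<dots>, (x\<^sub>n, y\<^sub>n)]\<close>, standing for the sum of the \<open>x\<^sub>i \<otimes> y\<^sub>i\<close>. Every module with
  carrier in \<open>'u\<close> occurs via \<open>Atom\<close>. The multiplication and unit components of the record
  type \<open>module\<close> are not used by the locale \<open>module\<close> and are left unspecified.
\<close>

datatype 'u univ = Atom 'u | Tensor "('u univ \<times> 'u univ) list"

fun terms :: "'u univ \<Rightarrow> ('u univ \<times> 'u univ) list" where
  "terms (Atom _) = []"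
| "terms (Tensor l) = l"

definition linear_map ::
  "('k, 'c) ring_scheme \<Rightarrow> ('k, 'a, 'd) module_scheme \<Rightarrow> ('k, 'b, 'e) module_scheme \<Rightarrow> ('a \<Rightarrow> 'b) \<Rightarrow> bool"
  where "linear_map k M N f \<longleftrightarrow>
    f \<in> carrier M \<rightarrow> carrier N \<and>
    (\<forall>x\<in>carrier M. \<forall>y\<in>carrier M. f (x \<oplus>\<^bsub>M\<^esub> y) = f x \<oplus>\<^bsub>N\<^esub> f y) \<and>
    (\<forall>r\<in>carrier k. \<forall>x\<in>carrier M. f (r \<odot>\<^bsub>M\<^esub> x) = r \<odot>\<^bsub>N\<^esub> f x)"

definition self_module :: "'k ring \<Rightarrow> ('k, 'k) module"
  where "self_module k = ring.extend k (module.fields (\<lambda>r x. r \<otimes>\<^bsub>k\<^esub> x))"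

text \<open>
  The equality of formal sums of pure tensors: the congruence on the free commutative monoid over
  \<open>M \<times> N\<close> generated by the bilinearity relations. The quotient is a group, since
  \<open>(\<ominus> x) \<otimes> y\<close> is inverse to \<open>x \<otimes> y\<close>, so it is the usual quotient of the free module.
\<close>

inductive tensor_eq ::
  "('k, 'c) ring_scheme \<Rightarrow> ('k, 'a, 'd) module_scheme \<Rightarrow> ('k, 'b, 'e) module_scheme \<Rightarrow>
    ('a \<times> 'b) list \<Rightarrow> ('a \<times> 'b) list \<Rightarrow> bool"
  for k M N where
  refl: "l \<in> lists (carrier M \<times> carrier N) \<Longrightarrow> tensor_eq k M N l l"
| sym: "tensor_eq k M N l l' \<Longrightarrow> tensor_eq k M N l' l"
| trans: "tensor_eq k M N l l' \<Longrightarrow> tensor_eq k M N l' l'' \<Longrightarrow> tensor_eq k M N l l''"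
| append: "tensor_eq k M N l\<^sub>1 l\<^sub>1' \<Longrightarrow> tensor_eq k M N l\<^sub>2 l\<^sub>2' \<Longrightarrow>
    tensor_eq k M N (l\<^sub>1 @ l\<^sub>2) (l\<^sub>1' @ l\<^sub>2')"
| comm: "l \<in> lists (carrier M \<times> carrier N) \<Longrightarrow> l' \<in> lists (carrier M \<times> carrier N) \<Longrightarrow>
    tensor_eq k M N (l @ l') (l' @ l)"
| zero: "y \<in> carrier N \<Longrightarrow> tensor_eq k M N [(\<zero>\<^bsub>M\<^esub>, y)] []"
| add_left: "x \<in> carrier M \<Longrightarrow> x' \<in> carrier M \<Longrightarrow> y \<in> carrier N \<Longrightarrow>
    tensor_eq k M N [(x \<oplus>\<^bsub>M\<^esub> x', y)] [(x, y), (x', y)]"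
| add_right: "x \<in> carrier M \<Longrightarrow> y \<in> carrier N \<Longrightarrow> y' \<in> carrier N \<Longrightarrow>
    tensor_eq k M N [(x, y \<oplus>\<^bsub>N\<^esub> y')] [(x, y), (x, y')]"
| smult: "r \<in> carrier k \<Longrightarrow> x \<in> carrier M \<Longrightarrow> y \<in> carrier N \<Longrightarrow>
    tensor_eq k M N [(r \<odot>\<^bsub>M\<^esub> x, y)] [(x, r \<odot>\<^bsub>N\<^esub> y)]"

text \<open>Each class of formal sums is represented by a chosen element of it.\<close>

definition tensor_of_list ::
  "'k ring \<Rightarrow> ('k, 'u univ) module \<Rightarrow> ('k, 'u univ) module \<Rightarrow> ('u univ \<times> 'u univ) list \<Rightarrow> 'u univ"
  where "tensor_of_list k M N l = Tensor (SOME l'. tensor_eq k M N l l')"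

definition ptens ::
  "'k ring \<Rightarrow> ('k, 'u univ) module \<Rightarrow> ('k, 'u univ) module \<Rightarrow> 'u univ \<Rightarrow> 'u univ \<Rightarrow> 'u univ"
  where "ptens k M N x y = tensor_of_list k M N [(x, y)]"

definition tensor_module ::
  "'k ring \<Rightarrow> ('k, 'u univ) module \<Rightarrow> ('k, 'u univ) module \<Rightarrow> ('k, 'u univ) module"
  where "tensor_module k M N =
    \<lparr> carrier = tensor_of_list k M N ` lists (carrier M \<times> carrier N),
      mult = undefined, one = undefined,
      zero = tensor_of_list k M N [],
      add = (\<lambda>s t. tensor_of_list k M N (terms s @ terms t)),
      smult = (\<lambda>r t. tensor_of_list k M N (map (\<lambda>(x, y). (r \<odot>\<^bsub>M\<^esub> x, y)) (terms t))) \<rparr>"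

text \<open>
  Sweedler notation: if \<open>t\<close> is written \<open>t\<^sub>1 \<otimes> t\<^sub>2\<close>, then \<open>sweedler P t B\<close> is the element
  \<open>B t\<^sub>1 t\<^sub>2\<close> of \<open>P\<close>, that is, the sum of the \<open>B x\<^sub>i y\<^sub>i\<close> over the representing list of \<open>t\<close>.
  For bilinear \<open>B\<close> this is the linear map on the tensor product induced by \<open>B\<close>, see
  \<open>sweedler_tensor_of_list\<close> below; it is only used for such \<open>B\<close>.
\<close>

definition sweedler ::
  "('k, 'p, 'd) module_scheme \<Rightarrow> 'u univ \<Rightarrow> ('u univ \<Rightarrow> 'u univ \<Rightarrow> 'p) \<Rightarrow> 'p"
  where "sweedler P t B = foldr (\<lambda>(x, y) s. B x y \<oplus>\<^bsub>P\<^esub> s) (terms t) \<zero>\<^bsub>P\<^esub>"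

lemma tensor_eq_lists:
  assumes "tensor_eq k M N l l'" "module k M" "module k N"
  shows "l \<in> lists (carrier M \<times> carrier N) \<and> l' \<in> lists (carrier M \<times> carrier N)"
proof -
  interpret M: module k M by fact
  interpret N: module k N by fact
  show ?thesis using assms(1) by induction auto
qed

lemma tensor_eq_sum:
  assumes "tensor_eq k M N l l'" "module k M" "module k N" "module k P"
    and lin1: "\<And>y. y \<in> carrier N \<Longrightarrow> linear_map k M P (\<lambda>x. B x y)"
    and lin2: "\<And>x. x \<in> carrier M \<Longrightarrow> linear_map k N P (B x)"
  shows "foldr (\<lambda>(x, y) s. B x y \<oplus>\<^bsub>P\<^esub> s) l \<zero>\<^bsub>P\<^esub> = foldr (\<lambda>(x, y) s. B x y \<oplus>\<^bsub>P\<^esub> s) l' \<zero>\<^bsub>P\<^esub>"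
proof -
  interpret M: module k M by fact
  interpret N: module k N by fact
  interpret P: module k P by fact
  let ?s = "\<lambda>l. foldr (\<lambda>(x, y) s. B x y \<oplus>\<^bsub>P\<^esub> s) l \<zero>\<^bsub>P\<^esub>"
  have B_closed: "B x y \<in> carrier P" if "x \<in> carrier M" "y \<in> carrier N" for x y
    using lin2[OF that(1)] that by (auto simp: linear_map_def)
  have closed: "?s l \<in> carrier P" if "l \<in> lists (carrier M \<times> carrier N)" for l
    using that by (induction l) (auto intro: B_closed)
  have app: "?s (l @ l') = ?s l \<oplus>\<^bsub>P\<^esub> ?s l'"
    if "l \<in> lists (carrier M \<times> carrier N)" "l' \<in> lists (carrier M \<times> carrier N)" for l l'
    using that(1)
  proof (induction l)
    case Nil
    then show ?case using closed[OF that(2)] by simp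
  next
    case (Cons p l)
    then show ?case
      using closed[OF that(2)] closed[of l] by (auto simp: P.a_assoc B_closed)
  qed
  have B0: "B \<zero>\<^bsub>M\<^esub> y = \<zero>\<^bsub>P\<^esub>" if "y \<in> carrier N" for y
  proof -
    have "B \<zero>\<^bsub>M\<^esub> y \<oplus>\<^bsub>P\<^esub> B \<zero>\<^bsub>M\<^esub> y = B \<zero>\<^bsub>M\<^esub> y"
    proof -
      have "B (\<zero>\<^bsub>M\<^esub> \<oplus>\<^bsub>M\<^esub> \<zero>\<^bsub>M\<^esub>) y = B \<zero>\<^bsub>M\<^esub> y \<oplus>\<^bsub>P\<^esub> B \<zero>\<^bsub>M\<^esub> y"
        using lin1[OF that] unfolding linear_map_def by blast
      then show ?thesis by simp
    qed
    then show ?thesis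
      using P.M.add.l_cancel_one[OF B_closed[OF M.M.zero_closed that] B_closed[OF M.M.zero_closed that]]
      by (rule iffD1[rotated])
  qed
  show ?thesis
    using assms(1)
  proof induction
    case (append l\<^sub>1 l\<^sub>1' l\<^sub>2 l\<^sub>2')
    from tensor_eq_lists[OF append.hyps(1) assms(2,3)] tensor_eq_lists[OF append.hyps(2) assms(2,3)]
    show ?case
      by (simp only: app append.IH)
  next
    case (comm l l')
    then show ?case
      by (simp only: app P.a_comm[OF closed closed])
  next
    case (add_left x x' y)
    then show ?case using lin1[of y] B_closed by (auto simp: linear_map_def)
  next
    case (add_right x y y')
    then show ?case using lin2[of x] B_closed by (auto simp: linear_map_def)
  next
    case (smult r x y)
    then show ?case using lin1[of y] lin2[of x] by (auto simp: linear_map_def)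
  qed (auto simp: B0)
qed

lemma sweedler_tensor_of_list:
  assumes "module k M" "module k N" "module k P" "l \<in> lists (carrier M \<times> carrier N)"
    and "\<And>y. y \<in> carrier N \<Longrightarrow> linear_map k M P (\<lambda>x. B x y)"
    and "\<And>x. x \<in> carrier M \<Longrightarrow> linear_map k N P (B x)"
  shows "sweedler P (tensor_of_list k M N l) B = foldr (\<lambda>(x, y) s. B x y \<oplus>\<^bsub>P\<^esub> s) l \<zero>\<^bsub>P\<^esub>"
proof -
  have "tensor_eq k M N l (SOME l'. tensor_eq k M N l l')"
    using tensor_eq.refl[OF assms(4)] by (rule someI)
  from tensor_eq_sum[OF this assms(1-3,5,6)] show ?thesis
    by (simp add: sweedler_def tensor_of_list_def)
qed

lemma tensor_of_list_eq_iff: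
  assumes "l \<in> lists (carrier M \<times> carrier N)" "l' \<in> lists (carrier M \<times> carrier N)"
  shows "tensor_of_list k M N l = tensor_of_list k M N l' \<longleftrightarrow> tensor_eq k M N l l'"
proof
  have some: "tensor_eq k M N l (SOME l'. tensor_eq k M N l l')"
    if "l \<in> lists (carrier M \<times> carrier N)" for l
    using tensor_eq.refl[OF that] by (rule someI)
  assume "tensor_of_list k M N l = tensor_of_list k M N l'"
  then show "tensor_eq k M N l l'"
    using some[OF assms(1)] some[OF assms(2)]
    by (metis tensor_of_list_def univ.inject(2) tensor_eq.sym tensor_eq.trans)
next
  assume "tensor_eq k M N l l'"
  then have "tensor_eq k M N l = tensor_eq k M N l'"
    by (intro ext) (metis tensor_eq.sym tensor_eq.trans)
  then show "tensor_of_list k M N l = tensor_of_list k M N l'"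
    by (simp add: tensor_of_list_def)
qed

section \<open>Objects with automorphism\<close>

record ('k, 'u) hom_obj =
  und :: "('k, 'u univ) module"
  aut :: "'u univ \<Rightarrow> 'u univ"

definition is_hom_obj :: "'k ring \<Rightarrow> ('k, 'u, 'e) hom_obj_scheme \<Rightarrow> bool"
  where "is_hom_obj k X \<longleftrightarrow>
    module k (und X) \<and> linear_map k (und X) (und X) (aut X) \<and>
    bij_betw (aut X) (carrier (und X)) (carrier (und X))"

abbreviation elts :: "('k, 'u, 'e) hom_obj_scheme \<Rightarrow> 'u univ set"
  where "elts X \<equiv> carrier (und X)"

definition aut_inv :: "('k, 'u, 'e) hom_obj_scheme \<Rightarrow> 'u univ \<Rightarrow> 'u univ"
  where "aut_inv X = inv_into (elts X) (aut X)"

definition tens :: "'k ring \<Rightarrow> ('k, 'u, 'e) hom_obj_scheme \<Rightarrow> ('k, 'u, 'f) hom_obj_scheme \<Rightarrow> ('k, 'u) hom_obj"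
  where "tens k X Y =
    \<lparr> und = tensor_module k (und X) (und Y),
      aut = (\<lambda>t. sweedler (tensor_module k (und X) (und Y)) t
        (\<lambda>x y. ptens k (und X) (und Y) (aut X x) (aut Y y))) \<rparr>"

abbreviation pure_tensor ::
  "'u univ \<Rightarrow> ('k, 'u, 'e) hom_obj_scheme \<Rightarrow> 'k ring \<Rightarrow> ('k, 'u, 'f) hom_obj_scheme \<Rightarrow> 'u univ \<Rightarrow> 'u univ"
  (\<open>(_ \<otimes>[_,_,_] _)\<close> [71, 0, 0, 0, 71] 70)
  where "x \<otimes>[X,k,Y] y \<equiv> ptens k (und X) (und Y) x y"

text \<open>
  Morphisms are functions that are \<open>undefined\<close> outside the carrier of the domain, so that equality
  of morphisms is equality of functions.
\<close>

definition hom_obj_mor ::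
  "'k ring \<Rightarrow> ('k, 'u, 'e) hom_obj_scheme \<Rightarrow> ('k, 'u, 'f) hom_obj_scheme \<Rightarrow> ('u univ \<Rightarrow> 'u univ) \<Rightarrow> bool"
  where "hom_obj_mor k X Y f \<longleftrightarrow>
    f \<in> extensional (elts X) \<and> linear_map k (und X) (und Y) f \<and>
    (\<forall>x\<in>elts X. aut Y (f x) = f (aut X x))"

section \<open>Monoidal Hom-algebras, Hom-coalgebras and Hom-Hopf algebras\<close>

record ('k, 'u) hom_alg = "('k, 'u) hom_obj" +
  mult_map :: "'u univ \<Rightarrow> 'u univ"
  unit_elt :: "'u univ"

definition amul :: "'k ring \<Rightarrow> ('k, 'u, 'e) hom_alg_scheme \<Rightarrow> 'u univ \<Rightarrow> 'u univ \<Rightarrow> 'u univ"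
  where "amul k A a b = mult_map A (a \<otimes>[A,k,A] b)"

definition is_hom_alg :: "'k ring \<Rightarrow> ('k, 'u, 'e) hom_alg_scheme \<Rightarrow> bool"
  where "is_hom_alg k A \<longleftrightarrow>
    is_hom_obj k A \<and>
    linear_map k (und (tens k A A)) (und A) (mult_map A) \<and>
    unit_elt A \<in> elts A \<and>
    (\<forall>a\<in>elts A. \<forall>b\<in>elts A. aut A (amul k A a b) = amul k A (aut A a) (aut A b)) \<and>
    aut A (unit_elt A) = unit_elt A \<and>
    (\<forall>a\<in>elts A. \<forall>b\<in>elts A. \<forall>c\<in>elts A.
      amul k A (aut A a) (amul k A b c) = amul k A (amul k A a b) (aut A c)) \<and>
    (\<forall>a\<in>elts A. amul k A a (unit_elt A) = aut A a \<and> amul k A (unit_elt A) a = aut A a)"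

record ('k, 'u) hom_coalg = "('k, 'u) hom_obj" +
  comult :: "'u univ \<Rightarrow> 'u univ"
  counit :: "'u univ \<Rightarrow> 'k"

definition is_hom_coalg :: "'k ring \<Rightarrow> ('k, 'u, 'e) hom_coalg_scheme \<Rightarrow> bool"
  where "is_hom_coalg k C \<longleftrightarrow>
    is_hom_obj k C \<and>
    linear_map k (und C) (und (tens k C C)) (comult C) \<and>
    linear_map k (und C) (self_module k) (counit C) \<and>
    (\<forall>c\<in>elts C.
      comult C (aut C c) =
        sweedler (und (tens k C C)) (comult C c) (\<lambda>c1 c2. aut C c1 \<otimes>[C,k,C] aut C c2) \<and>
      counit C (aut C c) = counit C c \<and>
      sweedler (und (tens k C (tens k C C))) (comult C c) (\<lambda>c1 c2.
        sweedler (und (tens k C (tens k C C))) (comult C c2) (\<lambda>c21 c22.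
          aut_inv C c1 \<otimes>[C,k,tens k C C] (c21 \<otimes>[C,k,C] c22))) =
      sweedler (und (tens k C (tens k C C))) (comult C c) (\<lambda>c1 c2.
        sweedler (und (tens k C (tens k C C))) (comult C c1) (\<lambda>c11 c12.
          c11 \<otimes>[C,k,tens k C C] (c12 \<otimes>[C,k,C] aut_inv C c2))) \<and>
      sweedler (und C) (comult C c) (\<lambda>c1 c2. counit C c1 \<odot>\<^bsub>und C\<^esub> c2) = aut_inv C c \<and>
      sweedler (und C) (comult C c) (\<lambda>c1 c2. counit C c2 \<odot>\<^bsub>und C\<^esub> c1) = aut_inv C c)"

record ('k, 'u) hom_bialg = "('k, 'u) hom_alg" +
  bi_comult :: "'u univ \<Rightarrow> 'u univ"
  bi_counit :: "'u univ \<Rightarrow> 'k"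

definition coalg_of :: "('k, 'u, 'e) hom_bialg_scheme \<Rightarrow> ('k, 'u) hom_coalg"
  where "coalg_of H = \<lparr> und = und H, aut = aut H, comult = bi_comult H, counit = bi_counit H \<rparr>"

definition is_hom_bialg :: "'k ring \<Rightarrow> ('k, 'u, 'e) hom_bialg_scheme \<Rightarrow> bool"
  where "is_hom_bialg k H \<longleftrightarrow>
    is_hom_alg k H \<and> is_hom_coalg k (coalg_of H) \<and>
    (\<forall>a\<in>elts H. \<forall>b\<in>elts H.
      bi_comult H (amul k H a b) =
        sweedler (und (tens k H H)) (bi_comult H a) (\<lambda>a1 a2.
          sweedler (und (tens k H H)) (bi_comult H b) (\<lambda>b1 b2.
            amul k H a1 b1 \<otimes>[H,k,H] amul k H a2 b2)) \<and>
      bi_counit H (amul k H a b) = bi_counit H a \<otimes>\<^bsub>k\<^esub> bi_counit H b) \<and>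
    bi_comult H (unit_elt H) = unit_elt H \<otimes>[H,k,H] unit_elt H \<and>
    bi_counit H (unit_elt H) = \<one>\<^bsub>k\<^esub>"

definition is_hom_hopf_alg :: "'k ring \<Rightarrow> ('k, 'u, 'e) hom_bialg_scheme \<Rightarrow> bool"
  where "is_hom_hopf_alg k H \<longleftrightarrow>
    is_hom_bialg k H \<and>
    (\<exists>S. linear_map k (und H) (und H) S \<and>
      (\<forall>h\<in>elts H.
        S (aut H h) = aut H (S h) \<and>
        sweedler (und H) (bi_comult H h) (\<lambda>h1 h2. amul k H (S h1) h2) =
          bi_counit H h \<odot>\<^bsub>und H\<^esub> unit_elt H \<and>
        sweedler (und H) (bi_comult H h) (\<lambda>h1 h2. amul k H h1 (S h2)) =
          bi_counit H h \<odot>\<^bsub>und H\<^esub> unit_elt H))"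

section \<open>Hom-modules and Hom-comodules\<close>

text \<open>An action is a map \<open>f\<close> on \<open>M \<otimes> A\<close>, with \<open>dot k M A f m a\<close> being \<open>m \<cdot> a\<close>.\<close>

definition dot ::
  "'k ring \<Rightarrow> ('k, 'u, 'e) hom_obj_scheme \<Rightarrow> ('k, 'u, 'f) hom_obj_scheme \<Rightarrow>
    ('u univ \<Rightarrow> 'u univ) \<Rightarrow> 'u univ \<Rightarrow> 'u univ \<Rightarrow> 'u univ"
  where "dot k M A f m a = f (m \<otimes>[M,k,A] a)"

definition is_hom_module ::
  "'k ring \<Rightarrow> ('k, 'u, 'e) hom_alg_scheme \<Rightarrow> ('k, 'u, 'f) hom_obj_scheme \<Rightarrow> ('u univ \<Rightarrow> 'u univ) \<Rightarrow> bool"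
  where "is_hom_module k A M f \<longleftrightarrow>
    is_hom_obj k M \<and>
    linear_map k (und (tens k M A)) (und M) f \<and>
    (\<forall>m\<in>elts M. \<forall>a\<in>elts A.
      aut M (dot k M A f m a) = dot k M A f (aut M m) (aut A a)) \<and>
    (\<forall>m\<in>elts M. \<forall>a\<in>elts A. \<forall>b\<in>elts A.
      dot k M A f (dot k M A f m a) (aut A b) = dot k M A f (aut M m) (amul k A a b)) \<and>
    (\<forall>m\<in>elts M. dot k M A f m (unit_elt A) = aut M m)"

definition is_hom_comodule ::
  "'k ring \<Rightarrow> ('k, 'u, 'e) hom_coalg_scheme \<Rightarrow> ('k, 'u, 'f) hom_obj_scheme \<Rightarrow> ('u univ \<Rightarrow> 'u univ) \<Rightarrow> bool"
  where "is_hom_comodule k C M \<rho> \<longleftrightarrow>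
    is_hom_obj k M \<and>
    linear_map k (und M) (und (tens k M C)) \<rho> \<and>
    (\<forall>m\<in>elts M.
      \<rho> (aut M m) =
        sweedler (und (tens k M C)) (\<rho> m) (\<lambda>m0 m1. aut M m0 \<otimes>[M,k,C] aut C m1) \<and>
      sweedler (und (tens k M (tens k C C))) (\<rho> m) (\<lambda>m0 m1.
        sweedler (und (tens k M (tens k C C))) (\<rho> m0) (\<lambda>m00 m01.
          m00 \<otimes>[M,k,tens k C C] (m01 \<otimes>[C,k,C] aut_inv C m1))) =
      sweedler (und (tens k M (tens k C C))) (\<rho> m) (\<lambda>m0 m1.
        aut_inv M m0 \<otimes>[M,k,tens k C C] comult C m1) \<and>
      sweedler (und M) (\<rho> m) (\<lambda>m0 m1. counit C m1 \<odot>\<^bsub>und M\<^esub> m0) = aut_inv M m)"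

record ('k, 'u) comodule_alg = "('k, 'u) hom_alg" +
  coaction :: "'u univ \<Rightarrow> 'u univ"

definition is_comodule_alg :: "'k ring \<Rightarrow> ('k, 'u, 'e) hom_bialg_scheme \<Rightarrow> ('k, 'u, 'f) comodule_alg_scheme \<Rightarrow> bool"
  where "is_comodule_alg k H A \<longleftrightarrow>
    is_hom_alg k A \<and> is_hom_comodule k (coalg_of H) A (coaction A) \<and>
    (\<forall>a\<in>elts A. \<forall>b\<in>elts A.
      coaction A (amul k A a b) =
        sweedler (und (tens k A H)) (coaction A a) (\<lambda>a0 a1.
          sweedler (und (tens k A H)) (coaction A b) (\<lambda>b0 b1.
            amul k A a0 b0 \<otimes>[A,k,H] amul k H a1 b1))) \<and>
    coaction A (unit_elt A) = unit_elt A \<otimes>[A,k,H] unit_elt H"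

record ('k, 'u) module_coalg = "('k, 'u) hom_coalg" +
  action :: "'u univ \<Rightarrow> 'u univ"

definition is_module_coalg :: "'k ring \<Rightarrow> ('k, 'u, 'e) hom_bialg_scheme \<Rightarrow> ('k, 'u, 'f) module_coalg_scheme \<Rightarrow> bool"
  where "is_module_coalg k H C \<longleftrightarrow>
    is_hom_coalg k C \<and> is_hom_module k H C (action C) \<and>
    (\<forall>c\<in>elts C. \<forall>h\<in>elts H.
      comult C (dot k C H (action C) c h) =
        sweedler (und (tens k C C)) (comult C c) (\<lambda>c1 c2.
          sweedler (und (tens k C C)) (bi_comult H h) (\<lambda>h1 h2.
            dot k C H (action C) c1 h1 \<otimes>[C,k,C] dot k C H (action C) c2 h2)) \<and>
      counit C (dot k C H (action C) c h) = counit C c \<otimes>\<^bsub>k\<^esub> bi_counit H h)"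

definition doi_hom_hopf_datum ::
  "'k ring \<Rightarrow> ('k, 'u) hom_bialg \<Rightarrow> ('k, 'u) comodule_alg \<Rightarrow> ('k, 'u) module_coalg \<Rightarrow> bool"
  where "doi_hom_hopf_datum k H A C \<longleftrightarrow>
    is_hom_hopf_alg k H \<and> is_comodule_alg k H A \<and> is_module_coalg k H C"

section \<open>Categories, functors and adjunctions\<close>

text \<open>
  Hom-sets need not be disjoint, so composition and the action of a functor on morphisms take the
  objects involved as arguments; \<open>Comp \<C> X Y Z g f\<close> is \<open>g \<circ> f\<close> for \<open>f : X \<rightarrow> Y\<close> and
  \<open>g : Y \<rightarrow> Z\<close>.
\<close>

record ('o, 'm) cat =
  Ob :: "'o set"
  Hom :: "'o \<Rightarrow> 'o \<Rightarrow> 'm set"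
  Idm :: "'o \<Rightarrow> 'm"
  Comp :: "'o \<Rightarrow> 'o \<Rightarrow> 'o \<Rightarrow> 'm \<Rightarrow> 'm \<Rightarrow> 'm"

definition is_category :: "('o, 'm) cat \<Rightarrow> bool"
  where "is_category \<C> \<longleftrightarrow>
    (\<forall>X\<in>Ob \<C>. Idm \<C> X \<in> Hom \<C> X X) \<and>
    (\<forall>X\<in>Ob \<C>. \<forall>Y\<in>Ob \<C>. \<forall>Z\<in>Ob \<C>. \<forall>f\<in>Hom \<C> X Y. \<forall>g\<in>Hom \<C> Y Z.
      Comp \<C> X Y Z g f \<in> Hom \<C> X Z) \<and>
    (\<forall>X\<in>Ob \<C>. \<forall>Y\<in>Ob \<C>. \<forall>f\<in>Hom \<C> X Y.
      Comp \<C> X X Y f (Idm \<C> X) = f \<and> Comp \<C> X Y Y (Idm \<C> Y) f = f) \<and>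
    (\<forall>W\<in>Ob \<C>. \<forall>X\<in>Ob \<C>. \<forall>Y\<in>Ob \<C>. \<forall>Z\<in>Ob \<C>.
      \<forall>f\<in>Hom \<C> W X. \<forall>g\<in>Hom \<C> X Y. \<forall>h\<in>Hom \<C> Y Z.
      Comp \<C> W X Z (Comp \<C> X Y Z h g) f = Comp \<C> W Y Z h (Comp \<C> W X Y g f))"

record ('o, 'm, 'p, 'n) funct =
  obj_map :: "'o \<Rightarrow> 'p"
  arr_map :: "'o \<Rightarrow> 'o \<Rightarrow> 'm \<Rightarrow> 'n"

definition is_functor :: "('o, 'm) cat \<Rightarrow> ('p, 'n) cat \<Rightarrow> ('o, 'm, 'p, 'n) funct \<Rightarrow> bool"
  where "is_functor \<C> \<D> F \<longleftrightarrow>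
    (\<forall>X\<in>Ob \<C>. obj_map F X \<in> Ob \<D>) \<and>
    (\<forall>X\<in>Ob \<C>. \<forall>Y\<in>Ob \<C>. \<forall>f\<in>Hom \<C> X Y.
      arr_map F X Y f \<in> Hom \<D> (obj_map F X) (obj_map F Y)) \<and>
    (\<forall>X\<in>Ob \<C>. arr_map F X X (Idm \<C> X) = Idm \<D> (obj_map F X)) \<and>
    (\<forall>X\<in>Ob \<C>. \<forall>Y\<in>Ob \<C>. \<forall>Z\<in>Ob \<C>. \<forall>f\<in>Hom \<C> X Y. \<forall>g\<in>Hom \<C> Y Z.
      arr_map F X Z (Comp \<C> X Y Z g f) =
        Comp \<D> (obj_map F X) (obj_map F Y) (obj_map F Z) (arr_map F Y Z g) (arr_map F X Y f))"

text \<open>\<open>G : \<D> \<rightarrow> \<C>\<close> is right adjoint to \<open>F : \<C> \<rightarrow> \<D>\<close>: there is a bijection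
  \<open>\<Phi> X Y : \<D>(F X, Y) \<rightarrow> \<C>(X, G Y)\<close>, natural in \<open>X\<close> and \<open>Y\<close>.\<close>

definition is_right_adjoint ::
  "('o, 'm) cat \<Rightarrow> ('p, 'n) cat \<Rightarrow> ('o, 'm, 'p, 'n) funct \<Rightarrow> ('p, 'n, 'o, 'm) funct \<Rightarrow> bool"
  where "is_right_adjoint \<C> \<D> F G \<longleftrightarrow>
    is_category \<C> \<and> is_category \<D> \<and> is_functor \<C> \<D> F \<and> is_functor \<D> \<C> G \<and>
    (\<exists>\<Phi>.
      (\<forall>X\<in>Ob \<C>. \<forall>Y\<in>Ob \<D>.
        bij_betw (\<Phi> X Y) (Hom \<D> (obj_map F X) Y) (Hom \<C> X (obj_map G Y))) \<and>
      (\<forall>X\<in>Ob \<C>. \<forall>X'\<in>Ob \<C>. \<forall>Y\<in>Ob \<D>. \<forall>h\<in>Hom \<C> X' X. \<forall>f\<in>Hom \<D> (obj_map F X) Y.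
        \<Phi> X' Y (Comp \<D> (obj_map F X') (obj_map F X) Y f (arr_map F X' X h)) =
          Comp \<C> X' X (obj_map G Y) (\<Phi> X Y f) h) \<and>
      (\<forall>X\<in>Ob \<C>. \<forall>Y\<in>Ob \<D>. \<forall>Y'\<in>Ob \<D>. \<forall>g\<in>Hom \<D> Y Y'. \<forall>f\<in>Hom \<D> (obj_map F X) Y.
        \<Phi> X Y' (Comp \<D> (obj_map F X) Y Y' g f) =
          Comp \<C> X (obj_map G Y) (obj_map G Y') (arr_map G Y Y' g) (\<Phi> X Y f)))"

section \<open>The categories of Hom-modules and of Doi Hom-Hopf modules\<close>

record ('k, 'u) hom_mod = "('k, 'u) hom_obj" +
  act :: "'u univ \<Rightarrow> 'u univ"

record ('k, 'u) doi_mod = "('k, 'u) hom_mod" +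
  coact :: "'u univ \<Rightarrow> 'u univ"

definition a_linear ::
  "'k ring \<Rightarrow> ('k, 'u, 'e) hom_obj_scheme \<Rightarrow> ('k, 'u, 'f) hom_mod_scheme \<Rightarrow> ('k, 'u, 'g) hom_mod_scheme \<Rightarrow>
    ('u univ \<Rightarrow> 'u univ) \<Rightarrow> bool"
  where "a_linear k A M N f \<longleftrightarrow>
    (\<forall>m\<in>elts M. \<forall>a\<in>elts A. f (dot k M A (act M) m a) = dot k N A (act N) (f m) a)"

definition c_colinear ::
  "'k ring \<Rightarrow> ('k, 'u, 'e) hom_obj_scheme \<Rightarrow> ('k, 'u, 'f) doi_mod_scheme \<Rightarrow> ('k, 'u, 'g) doi_mod_scheme \<Rightarrow>
    ('u univ \<Rightarrow> 'u univ) \<Rightarrow> bool"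
  where "c_colinear k C M N f \<longleftrightarrow>
    (\<forall>m\<in>elts M. coact N (f m) =
      sweedler (und (tens k N C)) (coact M m) (\<lambda>m0 m1. f m0 \<otimes>[N,k,C] m1))"

definition is_doi_mod ::
  "'k ring \<Rightarrow> ('k, 'u, 'e) comodule_alg_scheme \<Rightarrow> ('k, 'u, 'f) module_coalg_scheme \<Rightarrow>
    ('k, 'u, 'h) hom_obj_scheme \<Rightarrow> ('k, 'u, 'g) doi_mod_scheme \<Rightarrow> bool"
  where "is_doi_mod k A C H M \<longleftrightarrow>
    is_hom_module k A M (act M) \<and> is_hom_comodule k C M (coact M) \<and>
    (\<forall>m\<in>elts M. \<forall>a\<in>elts A.
      coact M (dot k M A (act M) m a) =
        sweedler (und (tens k M C)) (coact M m) (\<lambda>m0 m1.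
          sweedler (und (tens k M C)) (coaction A a) (\<lambda>a0 a1.
            dot k M A (act M) m0 a0 \<otimes>[M,k,C] dot k C H (action C) m1 a1)))"

definition hom_mod_cat ::
  "'k ring \<Rightarrow> ('k, 'u, 'e) hom_alg_scheme \<Rightarrow> (('k, 'u) hom_mod, 'u univ \<Rightarrow> 'u univ) cat"
  where "hom_mod_cat k A =
    \<lparr> Ob = {M. is_hom_module k A M (act M)},
      Hom = (\<lambda>M N. {f. hom_obj_mor k M N f \<and> a_linear k A M N f}),
      Idm = (\<lambda>M. restrict (\<lambda>x. x) (elts M)),
      Comp = (\<lambda>L M N g f. compose (elts L) g f) \<rparr>"

definition doi_mod_cat ::
  "'k ring \<Rightarrow> ('k, 'u) hom_bialg \<Rightarrow> ('k, 'u) comodule_alg \<Rightarrow> ('k, 'u) module_coalg \<Rightarrow>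
    (('k, 'u) doi_mod, 'u univ \<Rightarrow> 'u univ) cat"
  where "doi_mod_cat k H A C =
    \<lparr> Ob = {M. is_doi_mod k A C H M},
      Hom = (\<lambda>M N. {f. hom_obj_mor k M N f \<and> a_linear k A M N f \<and> c_colinear k C M N f}),
      Idm = (\<lambda>M. restrict (\<lambda>x. x) (elts M)),
      Comp = (\<lambda>L M N g f. compose (elts L) g f) \<rparr>"

definition forget ::
  "(('k, 'u) doi_mod, 'u univ \<Rightarrow> 'u univ, ('k, 'u) hom_mod, 'u univ \<Rightarrow> 'u univ) funct"
  where "forget = \<lparr> obj_map = hom_mod.truncate, arr_map = (\<lambda>M N f. f) \<rparr>"

end

theory Submission
  imports Defs
begin

text \<open>
  The counit of the adjunction is \<open>M \<otimes> C \<rightarrow> M\<close>, \<open>m \<otimes> c \<mapsto> \<epsilon>(c) \<mu>(m)\<close>, and it is couniversal: an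
  \<open>A\<close>-linear \<open>f : X \<rightarrow> M\<close> on a Doi Hom-Hopf module factors uniquely through the Doi Hom-Hopf morphism
  \<open>x \<mapsto> f(x\<^sub>[\<^sub>0\<^sub>]) \<otimes> x\<^sub>[\<^sub>1\<^sub>]\<close>. Uniqueness holds because \<open>t\<^sub>[\<^sub>0\<^sub>] \<otimes> t\<^sub>[\<^sub>1\<^sub>]\<close> for \<open>t \<in> M \<otimes> C\<close> becomes \<open>t\<close>
  again when the counit is applied to \<open>t\<^sub>[\<^sub>0\<^sub>]\<close>. Functoriality of \<open>M \<mapsto> M \<otimes> C\<close> and naturality are
  formal consequences. All identities are checked on pure tensors, where they are the Hom-algebra
  axioms under multilinear kernels.
\<close>

section \<open>Linear and bilinear maps\<close>

text \<open>The twists by automorphisms are the constraints of the monoidal category of pairs (M,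
  \<mu>). Its associator sends (m \<otimes> n) \<otimes> p to \<mu>(m) \<otimes> (n \<otimes>
  \<pi>^-1(p)), and its right unit constraint sends m \<otimes> r to r \<mu>(m). The coaction of M
  \<otimes> C is M \<otimes> \<Delta> followed by the inverse associator, and the counit of the
  adjunction is M \<otimes> \<epsilon> followed by the unit constraint. Up to these maps the
  argument is the classical one for cofree comodules, and each twist is placed so as to cancel one
  produced by an axiom. The obstacle is the concrete tensor product. A tensor is a chosen list, so
  \<open>sweedler P t B\<close> is meaningful independently of that choice only for bilinear B, and
  (M \<otimes> C) \<otimes> C and M \<otimes> (C \<otimes> C) are different carriers. Therefore each
  axiom, an equation between tensors, is first turned into an equation valid under every multilinear
  kernel. In that form it applies deep inside nested Sweedler expressions and never requires an
  explicit reassociation; the price is a multilinearity check for almost every rewriting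
  step.\<close>

lemma linear_mapI:
  assumes "\<And>x. x \<in> carrier M \<Longrightarrow> f x \<in> carrier N"
    and "\<And>x y. x \<in> carrier M \<Longrightarrow> y \<in> carrier M \<Longrightarrow> f (x \<oplus>\<^bsub>M\<^esub> y) = f x \<oplus>\<^bsub>N\<^esub> f y"
    and "\<And>r x. r \<in> carrier k \<Longrightarrow> x \<in> carrier M \<Longrightarrow> f (r \<odot>\<^bsub>M\<^esub> x) = r \<odot>\<^bsub>N\<^esub> f x"
  shows "linear_map k M N f"
  using assms by (auto simp: linear_map_def)

lemma linear_map_closed: "linear_map k M N f \<Longrightarrow> x \<in> carrier M \<Longrightarrow> f x \<in> carrier N"
  by (auto simp: linear_map_def)

lemma linear_map_add:
  "linear_map k M N f \<Longrightarrow> x \<in> carrier M \<Longrightarrow> y \<in> carrier M \<Longrightarrow> f (x \<oplus>\<^bsub>M\<^esub> y) = f x \<oplus>\<^bsub>N\<^esub> f y"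
  by (auto simp: linear_map_def)

lemma linear_map_smult:
  "linear_map k M N f \<Longrightarrow> r \<in> carrier k \<Longrightarrow> x \<in> carrier M \<Longrightarrow> f (r \<odot>\<^bsub>M\<^esub> x) = r \<odot>\<^bsub>N\<^esub> f x"
  by (auto simp: linear_map_def)

lemma linear_map_zero:
  assumes "linear_map k M N f" "module k M" "module k N"
  shows "f \<zero>\<^bsub>M\<^esub> = \<zero>\<^bsub>N\<^esub>"
proof -
  interpret M: module k M by fact
  interpret N: module k N by fact
  show ?thesis
    using linear_map_smult[OF assms(1), of "\<zero>\<^bsub>k\<^esub>" "\<zero>\<^bsub>M\<^esub>"] linear_map_closed[OF assms(1)] by simp
qed

lemma linear_map_id: "linear_map k M M (\<lambda>x. x)"
  by (auto simp: linear_map_def)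

lemma linear_map_comp:
  "linear_map k N P g \<Longrightarrow> linear_map k M N f \<Longrightarrow> linear_map k M P (\<lambda>x. g (f x))"
  by (rule linear_mapI) (auto simp: linear_map_closed linear_map_add linear_map_smult)

text \<open>Morphisms are formulas cut down by \<open>restrict\<close> or \<open>compose\<close>, so
  linearity has to be transferred to functions that agree with a linear one on the carrier. Closure
  of the carrier comes from \<open>module k M\<close>.\<close>

lemma linear_map_cong:
  assumes "linear_map k M N f" "module k M" "\<And>x. x \<in> carrier M \<Longrightarrow> g x = f x"
  shows "linear_map k M N g"
proof -
  interpret M: module k M by fact
  show ?thesis
    using assms by (auto intro!: linear_mapI simp: linear_map_closed linear_map_add linear_map_smult)
qed

lemma linear_map_smult_right:
  assumes "module k N" "r \<in> carrier k" "linear_map k M N f"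
  shows "linear_map k M N (\<lambda>x. r \<odot>\<^bsub>N\<^esub> f x)"
proof -
  interpret N: module k N by fact
  show ?thesis
    using assms(2,3)
    by (auto intro!: linear_mapI
        simp: linear_map_closed linear_map_add linear_map_smult N.smult_r_distr N.smult_assoc1[symmetric] N.m_comm)
qed

lemma linear_map_smult_left:
  assumes "module k N" "y \<in> carrier N" "linear_map k M (self_module k) f"
  shows "linear_map k M N (\<lambda>x. f x \<odot>\<^bsub>N\<^esub> y)"
proof -
  interpret N: module k N by fact
  have "f x \<in> carrier k" if "x \<in> carrier M" for x
    using linear_map_closed[OF assms(3) that] by (simp add: self_module_def ring.defs)
  moreover have "f (x \<oplus>\<^bsub>M\<^esub> x') = f x \<oplus>\<^bsub>k\<^esub> f x'" if "x \<in> carrier M" "x' \<in> carrier M" for x x'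
    using linear_map_add[OF assms(3) that] by (simp add: self_module_def ring.defs)
  moreover have "f (r \<odot>\<^bsub>M\<^esub> x) = r \<otimes>\<^bsub>k\<^esub> f x" if "r \<in> carrier k" "x \<in> carrier M" for r x
    using linear_map_smult[OF assms(3) that] by (simp add: self_module_def ring.defs module.defs)
  ultimately show ?thesis
    using assms(2) by (auto intro!: linear_mapI simp: N.smult_l_distr N.smult_assoc1)
qed

text \<open>These are the two conditions under which \<open>sweedler_tensor_of_list\<close> makes
  \<open>sweedler\<close> independent of the representing list.\<close>

definition bilinear_map where
  "bilinear_map k M N P B \<longleftrightarrow>
    (\<forall>y\<in>carrier N. linear_map k M P (\<lambda>x. B x y)) \<and> (\<forall>x\<in>carrier M. linear_map k N P (B x))"

lemma bilinear_mapI: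
  assumes "\<And>y. y \<in> carrier N \<Longrightarrow> linear_map k M P (\<lambda>x. B x y)"
    and "\<And>x. x \<in> carrier M \<Longrightarrow> linear_map k N P (\<lambda>y. B x y)"
  shows "bilinear_map k M N P B"
  using assms by (auto simp: bilinear_map_def)

lemma bilinear_map_left:
  "bilinear_map k M N P B \<Longrightarrow> linear_map k X M f \<Longrightarrow> y \<in> carrier N \<Longrightarrow> linear_map k X P (\<lambda>x. B (f x) y)"
  by (auto simp: bilinear_map_def intro: linear_map_comp[of k M P "\<lambda>x. B x y"])

lemma bilinear_map_right:
  "bilinear_map k M N P B \<Longrightarrow> x \<in> carrier M \<Longrightarrow> linear_map k X N f \<Longrightarrow> linear_map k X P (\<lambda>y. B x (f y))"
  by (auto simp: bilinear_map_def intro: linear_map_comp[of k N P "B x"])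

lemma bilinear_map_closed:
  "bilinear_map k M N P B \<Longrightarrow> x \<in> carrier M \<Longrightarrow> y \<in> carrier N \<Longrightarrow> B x y \<in> carrier P"
  by (auto simp: bilinear_map_def linear_map_def)

section \<open>The tensor product\<close>

lemma tensor_of_list_some:
  assumes "l \<in> lists (carrier M \<times> carrier N)"
  shows "tensor_eq k M N l (terms (tensor_of_list k M N l))"
  using tensor_eq.refl[OF assms] by (auto simp: tensor_of_list_def intro: someI)

lemma tensor_of_list_terms:
  assumes "module k M" "module k N" "l \<in> lists (carrier M \<times> carrier N)"
  shows "terms (tensor_of_list k M N l) \<in> lists (carrier M \<times> carrier N)"
    and "tensor_of_list k M N (terms (tensor_of_list k M N l)) = tensor_of_list k M N l"
proof -
  note eq = tensor_of_list_some[OF assms(3), of k]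
  show lists: "terms (tensor_of_list k M N l) \<in> lists (carrier M \<times> carrier N)"
    using tensor_eq_lists[OF eq assms(1,2)] by simp
  show "tensor_of_list k M N (terms (tensor_of_list k M N l)) = tensor_of_list k M N l"
    using tensor_of_list_eq_iff[OF assms(3) lists, of k] eq by simp
qed

lemma tensor_module_elem:
  assumes "t \<in> carrier (tensor_module k M N)"
  obtains l where "l \<in> lists (carrier M \<times> carrier N)" "t = tensor_of_list k M N l"
  using assms by (auto simp: tensor_module_def)

lemma tensor_module_terms:
  assumes "module k M" "module k N" "t \<in> carrier (tensor_module k M N)"
  shows "terms t \<in> lists (carrier M \<times> carrier N)"
  using assms(3) tensor_of_list_terms(1)[OF assms(1,2)] by (elim tensor_module_elem) simp

lemma tensor_of_list_closed:
  "l \<in> lists (carrier M \<times> carrier N) \<Longrightarrow> tensor_of_list k M N l \<in> carrier (tensor_module k M N)"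
  by (auto simp: tensor_module_def)

lemma tensor_of_list_Nil: "\<zero>\<^bsub>tensor_module k M N\<^esub> = tensor_of_list k M N []"
  by (simp add: tensor_module_def)

lemma tensor_of_list_append:
  assumes "module k M" "module k N"
    and "l \<in> lists (carrier M \<times> carrier N)" "l' \<in> lists (carrier M \<times> carrier N)"
  shows "tensor_of_list k M N l \<oplus>\<^bsub>tensor_module k M N\<^esub> tensor_of_list k M N l' = tensor_of_list k M N (l @ l')"
proof -
  have "tensor_eq k M N (l @ l') (terms (tensor_of_list k M N l) @ terms (tensor_of_list k M N l'))"
    using assms by (intro tensor_eq.append tensor_of_list_some)
  then show ?thesis
    using assms tensor_of_list_terms(1)[OF assms(1,2)]
    by (auto simp: tensor_module_def tensor_of_list_eq_iff intro: tensor_eq.sym)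
qed

text \<open>Well-definedness of the scalar action on classes. Scaling first entries respects every
  generator of the congruence; for the relation that moves a scalar s across the tensor this rests
  on r s = s r in the base ring.\<close>

lemma tensor_eq_map_smult:
  assumes "tensor_eq k M N l l'" "module k M" "module k N" "r \<in> carrier k"
  shows "tensor_eq k M N (map (\<lambda>(x, y). (r \<odot>\<^bsub>M\<^esub> x, y)) l) (map (\<lambda>(x, y). (r \<odot>\<^bsub>M\<^esub> x, y)) l')"
proof -
  interpret M: module k M by fact
  interpret N: module k N by fact
  have lists: "map (\<lambda>(x, y). (r \<odot>\<^bsub>M\<^esub> x, y)) l \<in> lists (carrier M \<times> carrier N)"
    if "l \<in> lists (carrier M \<times> carrier N)" for l
    using that assms(4) by (induction l) auto
  show ?thesis
    using assms(1)
  proof induction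
    case (smult s x y)
    have "r \<odot>\<^bsub>M\<^esub> (s \<odot>\<^bsub>M\<^esub> x) = s \<odot>\<^bsub>M\<^esub> (r \<odot>\<^bsub>M\<^esub> x)"
      using smult assms(4) by (metis M.m_comm M.smult_assoc1)
    then show ?case
      using smult assms(4) tensor_eq.smult[of s k "r \<odot>\<^bsub>M\<^esub> x" M y N] by simp
  next
    case (trans l l' l'')
    then show ?case by (blast intro: tensor_eq.trans)
  qed (use assms(4) lists in \<open>auto simp: M.smult_r_distr intro: tensor_eq.intros\<close>)
qed

lemma tensor_of_list_smult:
  assumes "module k M" "module k N" "l \<in> lists (carrier M \<times> carrier N)" "r \<in> carrier k"
  shows "r \<odot>\<^bsub>tensor_module k M N\<^esub> tensor_of_list k M N l =
    tensor_of_list k M N (map (\<lambda>(x, y). (r \<odot>\<^bsub>M\<^esub> x, y)) l)"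
proof -
  interpret M: module k M by fact
  interpret N: module k N by fact
  note eq = tensor_eq_map_smult[OF tensor_of_list_some[OF assms(3)] assms(1,2,4)]
  show ?thesis
    using eq tensor_eq_lists[OF eq assms(1,2)]
    by (auto simp: tensor_module_def tensor_of_list_eq_iff intro: tensor_eq.sym)
qed

text \<open>Formal sums are built as a commutative monoid, so additive inverses have to come from
  the scalars: l scaled by -1 is inverse to l, because (-1 + 1) l = 0 l and a list of pairs with
  first entry zero is congruent to the empty list.\<close>

lemma module_tensor_module:
  assumes "module k M" "module k N"
  shows "module k (tensor_module k M N)"
proof -
  interpret M: module k M by fact
  interpret N: module k N by fact
  let ?T = "tensor_module k M N" and ?L = "lists (carrier M \<times> carrier N)"
  let ?t = "tensor_of_list k M N" and ?m = "\<lambda>r. map (\<lambda>(x, y). (r \<odot>\<^bsub>M\<^esub> x, y))"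
  note add = tensor_of_list_append[OF assms] and smult = tensor_of_list_smult[OF assms]
    and closed = tensor_of_list_closed[of _ M N k]
  have lists: "?m r l \<in> ?L" if "l \<in> ?L" "r \<in> carrier k" for r l
    using that by (induction l) auto
  have eqI: "?t l = ?t l'" if "l \<in> ?L" "tensor_eq k M N l l'" for l l'
    using that tensor_eq_lists[OF that(2) assms] by (simp add: tensor_of_list_eq_iff)
  have comm: "?t (l @ l') = ?t (l' @ l)" if "l \<in> ?L" "l' \<in> ?L" for l l'
    using that by (intro eqI tensor_eq.comm) auto
  \<comment> \<open>Used both as a module axiom and, with -1 and 1, for the additive inverse. The
    congruence splits one pair at a time, so the induction splits the head and then moves one of its
    halves past the scaled tail.\<close>
  have distr: "?t (?m (r \<oplus>\<^bsub>k\<^esub> s) l) = ?t (?m r l @ ?m s l)"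
    if l: "l \<in> ?L" and rs: "r \<in> carrier k" "s \<in> carrier k" for r s l
    using l
  proof (induction l)
    case (Cons p l)
    obtain x y where p: "p = (x, y)" by force
    with Cons.hyps have xy: "x \<in> carrier M" "y \<in> carrier N" and l: "l \<in> ?L" by auto
    note L = lists[OF l rs(1)] lists[OF l rs(2)] lists[OF l, of "r \<oplus>\<^bsub>k\<^esub> s"]
    have 1: "?t [((r \<oplus>\<^bsub>k\<^esub> s) \<odot>\<^bsub>M\<^esub> x, y)] = ?t [(r \<odot>\<^bsub>M\<^esub> x, y), (s \<odot>\<^bsub>M\<^esub> x, y)]"
      using xy rs by (intro eqI) (auto simp: M.smult_l_distr intro: tensor_eq.add_left)
    have "?t (?m (r \<oplus>\<^bsub>k\<^esub> s) (p # l)) = ?t [((r \<oplus>\<^bsub>k\<^esub> s) \<odot>\<^bsub>M\<^esub> x, y)] \<oplus>\<^bsub>?T\<^esub> ?t (?m (r \<oplus>\<^bsub>k\<^esub> s) l)"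
      using L rs xy by (subst add) (auto simp: p)
    also have "\<dots> = ?t ([(r \<odot>\<^bsub>M\<^esub> x, y), (s \<odot>\<^bsub>M\<^esub> x, y)] @ ?m r l @ ?m s l)"
      unfolding 1 Cons.IH using L rs xy by (subst add) auto
    also have "\<dots> = ?t [(r \<odot>\<^bsub>M\<^esub> x, y)] \<oplus>\<^bsub>?T\<^esub> ?t ([(s \<odot>\<^bsub>M\<^esub> x, y)] @ ?m r l) \<oplus>\<^bsub>?T\<^esub> ?t (?m s l)"
      using L rs xy by (subst add, simp_all)+
    also have "?t ([(s \<odot>\<^bsub>M\<^esub> x, y)] @ ?m r l) = ?t (?m r l @ [(s \<odot>\<^bsub>M\<^esub> x, y)])"
      using L rs xy by (intro comm) auto
    also have "?t [(r \<odot>\<^bsub>M\<^esub> x, y)] \<oplus>\<^bsub>?T\<^esub> \<dots> \<oplus>\<^bsub>?T\<^esub> ?t (?m s l) = ?t (?m r (p # l) @ ?m s (p # l))"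
      using L rs xy by (subst add, simp_all add: p)+
    finally show ?case .
  qed simp
  have group: "abelian_group ?T"
  proof (rule abelian_groupI)
    fix t assume "t \<in> carrier ?T"
    then obtain l where l: "l \<in> ?L" "t = ?t l" by (rule tensor_module_elem)
    have zero: "?t (?m \<zero>\<^bsub>k\<^esub> l) = ?t []"
      using l(1)
    proof (induction l)
      case (Cons p l)
      then have "tensor_eq k M N (?m \<zero>\<^bsub>k\<^esub> [p] @ ?m \<zero>\<^bsub>k\<^esub> l) ([] @ [])"
        using lists by (intro tensor_eq.append) (auto simp: tensor_of_list_eq_iff intro: tensor_eq.zero)
      then show ?case using Cons lists by (intro eqI) auto
    qed simp
    have m1: "?m \<one>\<^bsub>k\<^esub> l = l"
      using l(1) by (induction l) auto
    have "\<ominus>\<^bsub>k\<^esub> \<one>\<^bsub>k\<^esub> \<oplus>\<^bsub>k\<^esub> \<one>\<^bsub>k\<^esub> = \<zero>\<^bsub>k\<^esub>"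
      by (simp add: M.R.l_neg)
    then have "?t (?m (\<ominus>\<^bsub>k\<^esub> \<one>\<^bsub>k\<^esub>) l) \<oplus>\<^bsub>?T\<^esub> t = \<zero>\<^bsub>?T\<^esub>"
      using l lists[OF l(1)] distr[OF l(1), of "\<ominus>\<^bsub>k\<^esub> \<one>\<^bsub>k\<^esub>" "\<one>\<^bsub>k\<^esub>"]
      by (simp add: add m1 zero tensor_of_list_Nil)
    then show "\<exists>s\<in>carrier ?T. s \<oplus>\<^bsub>?T\<^esub> t = \<zero>\<^bsub>?T\<^esub>"
      using lists[OF l(1)] closed by auto
  qed ((elim tensor_module_elem)?; simp add: add tensor_of_list_Nil closed comm del: in_lists_conv_set)+
  show ?thesis
  proof (rule moduleI)
    fix r s t assume r: "r \<in> carrier k" and s: "s \<in> carrier k" and "t \<in> carrier ?T"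
    then obtain l where l: "l \<in> ?L" "t = ?t l" by (elim tensor_module_elem)
    have "?m r (?m s l) = ?m (r \<otimes>\<^bsub>k\<^esub> s) l"
      using l(1) r s by (induction l) (auto simp: M.smult_assoc1)
    then show "(r \<otimes>\<^bsub>k\<^esub> s) \<odot>\<^bsub>?T\<^esub> t = r \<odot>\<^bsub>?T\<^esub> (s \<odot>\<^bsub>?T\<^esub> t)"
      using l r s lists by (simp add: smult del: map_map)
    show "(r \<oplus>\<^bsub>k\<^esub> s) \<odot>\<^bsub>?T\<^esub> t = r \<odot>\<^bsub>?T\<^esub> t \<oplus>\<^bsub>?T\<^esub> s \<odot>\<^bsub>?T\<^esub> t"
      using l r s lists distr by (simp add: smult add)
  next
    fix t assume "t \<in> carrier ?T"
    then obtain l where l: "l \<in> ?L" "t = ?t l" by (rule tensor_module_elem)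
    have "?m \<one>\<^bsub>k\<^esub> l = l"
      using l(1) by (induction l) auto
    then show "\<one>\<^bsub>k\<^esub> \<odot>\<^bsub>?T\<^esub> t = t"
      using l by (simp add: smult)
  qed ((elim tensor_module_elem)?; simp add: group M.is_cring lists closed smult add del: in_lists_conv_set)+
qed

lemma bilinear_map_ptens:
  assumes "module k M" "module k N"
  shows "bilinear_map k M N (tensor_module k M N) (ptens k M N)"
proof -
  interpret M: module k M by fact
  interpret N: module k N by fact
  show ?thesis
    unfolding ptens_def
    by (intro bilinear_mapI linear_mapI)
      (auto simp: tensor_of_list_closed tensor_of_list_append[OF assms] tensor_of_list_smult[OF assms]
        tensor_of_list_eq_iff
        intro: tensor_eq.add_left tensor_eq.add_right tensor_eq.smult tensor_eq.smult[THEN tensor_eq.sym])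
qed

text \<open>Tensors are finite sums of pure tensors, so induction over a representing list suffices.
  Identities between structure maps on a tensor product are reduced to pure tensors by this lemma,
  once both sides are known to be linear.\<close>

lemma tensor_module_ext:
  assumes "module k M" "module k N" "module k P"
    and f: "linear_map k (tensor_module k M N) P f" and g: "linear_map k (tensor_module k M N) P g"
    and eq: "\<And>x y. x \<in> carrier M \<Longrightarrow> y \<in> carrier N \<Longrightarrow> f (ptens k M N x y) = g (ptens k M N x y)"
    and "t \<in> carrier (tensor_module k M N)"
  shows "f t = g t"
proof -
  note T = module_tensor_module[OF assms(1,2)]
  obtain l where l: "l \<in> lists (carrier M \<times> carrier N)" "t = tensor_of_list k M N l"
    using assms(7) by (rule tensor_module_elem)
  from l(1) have "f (tensor_of_list k M N l) = g (tensor_of_list k M N l)"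
  proof (induction l)
    case Nil
    then show ?case
      using linear_map_zero[OF f T assms(3)] linear_map_zero[OF g T assms(3)]
      by (simp add: tensor_of_list_Nil)
  next
    case (Cons p l)
    obtain x y where p: "p = (x, y)" by force
    with Cons.hyps have xy: "x \<in> carrier M" "y \<in> carrier N" and "l \<in> lists (carrier M \<times> carrier N)" by auto
    moreover have "tensor_of_list k M N (p # l) =
        ptens k M N x y \<oplus>\<^bsub>tensor_module k M N\<^esub> tensor_of_list k M N l"
      using \<open>l \<in> _\<close> xy tensor_of_list_append[OF assms(1,2), of "[(x, y)]" l] by (simp add: p ptens_def)
    ultimately show ?case
      using Cons.IH eq[OF xy] bilinear_map_closed[OF bilinear_map_ptens[OF assms(1,2)] xy]
      by (simp add: linear_map_add[OF f] linear_map_add[OF g] tensor_of_list_closed)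
  qed
  then show ?thesis by (simp add: l)
qed

section \<open>Sweedler calculus\<close>

lemma sweedler_closed:
  assumes "t \<in> carrier (tensor_module k M N)" "module k M" "module k N" "module k P"
    and "\<And>x y. x \<in> carrier M \<Longrightarrow> y \<in> carrier N \<Longrightarrow> B x y \<in> carrier P"
  shows "sweedler P t B \<in> carrier P"
proof -
  interpret P: module k P by fact
  have "foldr (\<lambda>(x, y) s. B x y \<oplus>\<^bsub>P\<^esub> s) l \<zero>\<^bsub>P\<^esub> \<in> carrier P"
    if "l \<in> lists (carrier M \<times> carrier N)" for l
    using that by (induction l) (auto simp: assms(5))
  then show ?thesis
    using tensor_module_terms[OF assms(2,3,1)] by (simp add: sweedler_def)
qed

text \<open>The fold runs over one list with entries in the carriers, so agreement of the kernels
  there is enough. This is the means of rewriting under bound Sweedler variables.\<close>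

lemma sweedler_cong:
  assumes "t \<in> carrier (tensor_module k M N)" "module k M" "module k N"
    and "\<And>x y. x \<in> carrier M \<Longrightarrow> y \<in> carrier N \<Longrightarrow> B x y = B' x y"
  shows "sweedler P t B = sweedler P t B'"
proof -
  have "foldr (\<lambda>(x, y) s. B x y \<oplus>\<^bsub>P\<^esub> s) l z = foldr (\<lambda>(x, y) s. B' x y \<oplus>\<^bsub>P\<^esub> s) l z"
    if "l \<in> lists (carrier M \<times> carrier N)" for l z
    using that by (induction l) (auto simp: assms(4))
  then show ?thesis
    using tensor_module_terms[OF assms(2,3,1)] by (simp add: sweedler_def)
qed

lemma linear_map_sweedler:
  assumes "linear_map k P Q f" "module k P" "module k Q"
    and "t \<in> carrier (tensor_module k M N)" "module k M" "module k N"
    and "\<And>x y. x \<in> carrier M \<Longrightarrow> y \<in> carrier N \<Longrightarrow> B x y \<in> carrier P"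
  shows "f (sweedler P t B) = sweedler Q t (\<lambda>x y. f (B x y))"
proof -
  interpret P: module k P by fact
  have "foldr (\<lambda>(x, y) s. B x y \<oplus>\<^bsub>P\<^esub> s) l \<zero>\<^bsub>P\<^esub> \<in> carrier P \<and>
      f (foldr (\<lambda>(x, y) s. B x y \<oplus>\<^bsub>P\<^esub> s) l \<zero>\<^bsub>P\<^esub>) =
      foldr (\<lambda>(x, y) s. f (B x y) \<oplus>\<^bsub>Q\<^esub> s) l \<zero>\<^bsub>Q\<^esub>"
    if "l \<in> lists (carrier M \<times> carrier N)" for l
    using that
    by (induction l) (auto simp: assms(7) linear_map_add[OF assms(1)] linear_map_zero[OF assms(1-3)])
  then show ?thesis
    using tensor_module_terms[OF assms(5,6,4)] by (simp add: sweedler_def)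
qed

text \<open>The list chosen for a pure tensor may differ from the one-element list
  \<open>[(x, y)]\<close>; bilinearity is what makes the value independent of this choice.\<close>

lemma sweedler_ptens:
  assumes "bilinear_map k M N P B" "module k M" "module k N" "module k P" "x \<in> carrier M" "y \<in> carrier N"
  shows "sweedler P (ptens k M N x y) B = B x y"
proof -
  interpret P: module k P by fact
  show ?thesis
    using assms bilinear_map_closed[OF assms(1,5,6)]
    unfolding ptens_def by (subst sweedler_tensor_of_list) (auto simp: bilinear_map_def)
qed

text \<open>The universal property of the tensor product: the map induced by a bilinear kernel is
  linear. The inner linear map f is built into the statement so that the rule can be chained
  backwards through nested expressions.\<close>

lemma linear_map_sweedler_arg:
  assumes "linear_map k X (tensor_module k M N) f" "bilinear_map k M N P B"
    and "module k M" "module k N" "module k P"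
  shows "linear_map k X P (\<lambda>x. sweedler P (f x) B)"
proof -
  interpret P: module k P by fact
  interpret M: module k M by fact
  let ?s = "\<lambda>l. foldr (\<lambda>(x, y) s. B x y \<oplus>\<^bsub>P\<^esub> s) l \<zero>\<^bsub>P\<^esub>" and ?L = "lists (carrier M \<times> carrier N)"
  let ?m = "\<lambda>r. map (\<lambda>(x, y). (r \<odot>\<^bsub>M\<^esub> x, y))"
  have B: "B x y \<in> carrier P" if "x \<in> carrier M" "y \<in> carrier N" for x y
    using bilinear_map_closed[OF assms(2) that] .
  have closed: "?s l \<in> carrier P" if "l \<in> ?L" for l
    using that by (induction l) (auto simp: B)
  have sw: "sweedler P (tensor_of_list k M N l) B = ?s l" if "l \<in> ?L" for l
    using assms that by (subst sweedler_tensor_of_list) (auto simp: bilinear_map_def)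
  have app: "?s (l @ l') = ?s l \<oplus>\<^bsub>P\<^esub> ?s l'" if "l \<in> ?L" "l' \<in> ?L" for l l'
    using that(1)
  proof (induction l)
    case (Cons p l)
    then show ?case
      using closed[of l] closed[OF that(2)] by (auto simp: B P.a_assoc)
  qed (use closed[OF that(2)] in simp)
  have sm: "?m r l \<in> ?L \<and> ?s (?m r l) = r \<odot>\<^bsub>P\<^esub> ?s l" if "l \<in> ?L" "r \<in> carrier k" for r l
    using that(1)
  proof (induction l)
    case (Cons p l)
    obtain x y where p: "p = (x, y)" by force
    with Cons have "linear_map k M P (\<lambda>x. B x y)" "x \<in> carrier M"
      using assms(2) by (auto simp: bilinear_map_def)
    with that(2) have "B (r \<odot>\<^bsub>M\<^esub> x) y = r \<odot>\<^bsub>P\<^esub> B x y"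
      using linear_map_smult by metis
    then show ?case using Cons that(2) closed by (auto simp: B P.smult_r_distr p)
  qed (simp add: that(2))
  have "linear_map k (tensor_module k M N) P (\<lambda>t. sweedler P t B)"
    by (rule linear_mapI; elim tensor_module_elem)
      (simp_all add: sw closed tensor_of_list_append[OF assms(3,4)] tensor_of_list_smult[OF assms(3,4)] app sm del: foldr_append)
  then show ?thesis
    using assms(1) by (rule linear_map_comp)
qed

text \<open>Complements \<open>linear_map_sweedler_arg\<close>: a variable may occur in the tensor
  or, as here, in the kernel, where the claim is that a finite sum of linear maps is linear.\<close>

lemma linear_map_sweedler_body:
  assumes "t \<in> carrier (tensor_module k M N)" "module k M" "module k N" "module k P"
    and "\<And>u v. u \<in> carrier M \<Longrightarrow> v \<in> carrier N \<Longrightarrow> linear_map k X P (\<lambda>x. B x u v)"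
  shows "linear_map k X P (\<lambda>x. sweedler P t (B x))"
proof -
  interpret P: module k P by fact
  let ?s = "\<lambda>l x. foldr (\<lambda>(u, v) s. B x u v \<oplus>\<^bsub>P\<^esub> s) l \<zero>\<^bsub>P\<^esub>"
  have "linear_map k X P (?s l)" if "l \<in> lists (carrier M \<times> carrier N)" for l
    using that
  proof (induction l)
    case (Cons p l)
    obtain u v where p: "p = (u, v)" by force
    with Cons have "linear_map k X P (\<lambda>x. B x u v)" by (auto intro: assms(5))
    then show ?case
      using Cons.IH
      by (auto simp: p linear_map_def Pi_iff P.smult_r_distr P.M.add.m_ac)
  qed (auto simp: linear_map_def)
  then show ?thesis
    using tensor_module_terms[OF assms(2,3,1)] by (simp add: sweedler_def)
qed

text \<open>Fubini for Sweedler sums. Both sides are linear in t, and on a pure tensor t the sum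
  over t collapses to a single term on either side.\<close>

lemma sweedler_swap:
  assumes s: "s \<in> carrier (tensor_module k K L)" and t: "t \<in> carrier (tensor_module k M N)"
    and mods: "module k K" "module k L" "module k M" "module k N" "module k P"
    and B: "\<And>x y. x \<in> carrier K \<Longrightarrow> y \<in> carrier L \<Longrightarrow> bilinear_map k M N P (B x y)"
  shows "sweedler P s (\<lambda>x y. sweedler P t (B x y)) = sweedler P t (\<lambda>u v. sweedler P s (\<lambda>x y. B x y u v))"
proof (rule tensor_module_ext[OF mods(3-5) _ _ _ t])
  have left: "linear_map k M P (\<lambda>u. B x y u v)"
    if "x \<in> carrier K" "y \<in> carrier L" "v \<in> carrier N" for x y v
    using bilinear_map_left[OF B[OF that(1,2)] linear_map_id that(3)] .
  have right: "linear_map k N P (\<lambda>v. B x y u v)"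
    if "x \<in> carrier K" "y \<in> carrier L" "u \<in> carrier M" for x y u
    using bilinear_map_right[OF B[OF that(1,2)] that(3) linear_map_id] .
  have bil: "bilinear_map k M N P (\<lambda>u v. sweedler P s (\<lambda>x y. B x y u v))"
    by (intro bilinear_mapI linear_map_sweedler_body[OF s] mods left right)
  show "linear_map k (tensor_module k M N) P (\<lambda>t. sweedler P s (\<lambda>x y. sweedler P t (B x y)))"
    by (rule linear_map_sweedler_body[OF s] linear_map_sweedler_arg linear_map_id B mods | assumption)+
  show "linear_map k (tensor_module k M N) P (\<lambda>t. sweedler P t (\<lambda>u v. sweedler P s (\<lambda>x y. B x y u v)))"
    by (intro linear_map_sweedler_arg[OF linear_map_id bil] mods)
  fix u v assume uv: "u \<in> carrier M" "v \<in> carrier N"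
  show "sweedler P s (\<lambda>x y. sweedler P (ptens k M N u v) (B x y)) =
      sweedler P (ptens k M N u v) (\<lambda>u v. sweedler P s (\<lambda>x y. B x y u v))"
    unfolding sweedler_ptens[OF bil mods(3-5) uv]
    by (intro sweedler_cong[OF s mods(1,2)] sweedler_ptens B mods uv)
qed

definition trilinear_map where
  "trilinear_map k L M N P T \<longleftrightarrow>
    (\<forall>z\<in>carrier N. bilinear_map k L M P (\<lambda>x y. T x y z)) \<and>
    (\<forall>x\<in>carrier L. \<forall>y\<in>carrier M. linear_map k N P (T x y))"

lemma trilinear_mapI:
  assumes "\<And>y z. y \<in> carrier M \<Longrightarrow> z \<in> carrier N \<Longrightarrow> linear_map k L P (\<lambda>x. T x y z)"
    and "\<And>x z. x \<in> carrier L \<Longrightarrow> z \<in> carrier N \<Longrightarrow> linear_map k M P (\<lambda>y. T x y z)"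
    and "\<And>x y. x \<in> carrier L \<Longrightarrow> y \<in> carrier M \<Longrightarrow> linear_map k N P (\<lambda>z. T x y z)"
  shows "trilinear_map k L M N P T"
  using assms by (auto simp: trilinear_map_def bilinear_map_def)

text \<open>The linear map on L \<otimes> (M \<otimes> N) induced by a trilinear T; the bracketing
  is that of the coassociativity axioms.\<close>

definition sweedler3 where
  "sweedler3 P T s = sweedler P s (\<lambda>x w. sweedler P w (T x))"

lemma
  assumes T: "trilinear_map k L M N P T" and mods: "module k L" "module k M" "module k N" "module k P"
  shows linear_map_sweedler3: "linear_map k (tensor_module k L (tensor_module k M N)) P (sweedler3 P T)"
    and sweedler3_ptens: "x \<in> carrier L \<Longrightarrow> w \<in> carrier (tensor_module k M N) \<Longrightarrow>
      sweedler3 P T (ptens k L (tensor_module k M N) x w) = sweedler P w (T x)"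
    and sweedler3_ptens_ptens: "x \<in> carrier L \<Longrightarrow> y \<in> carrier M \<Longrightarrow> z \<in> carrier N \<Longrightarrow>
      sweedler3 P T (ptens k L (tensor_module k M N) x (ptens k M N y z)) = T x y z"
proof -
  have 1: "bilinear_map k M N P (T x)" if "x \<in> carrier L" for x
    using T that by (auto simp: trilinear_map_def bilinear_map_def)
  have 2: "linear_map k L P (\<lambda>x. T x y z)" if "y \<in> carrier M" "z \<in> carrier N" for y z
    using T that by (auto simp: trilinear_map_def bilinear_map_def)
  have bil: "bilinear_map k L (tensor_module k M N) P (\<lambda>x w. sweedler P w (T x))"
    by (rule bilinear_mapI linear_map_sweedler_arg linear_map_sweedler_body linear_map_id mods 1 2 | assumption)+
  show "linear_map k (tensor_module k L (tensor_module k M N)) P (sweedler3 P T)"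
    unfolding sweedler3_def
    by (rule linear_map_sweedler_arg[OF linear_map_id bil]) (intro mods module_tensor_module)+
  show *: "sweedler3 P T (ptens k L (tensor_module k M N) x w) = sweedler P w (T x)"
    if "x \<in> carrier L" "w \<in> carrier (tensor_module k M N)" for x w
    unfolding sweedler3_def using that by (intro sweedler_ptens bil mods module_tensor_module)
  show "sweedler3 P T (ptens k L (tensor_module k M N) x (ptens k M N y z)) = T x y z"
    if "x \<in> carrier L" "y \<in> carrier M" "z \<in> carrier N" for x y z
    using that bilinear_map_closed[OF bilinear_map_ptens[OF mods(2,3)]]
    by (simp add: * sweedler_ptens[OF 1] mods)
qed

lemma sweedler_sweedler:
  assumes "bilinear_map k K L Q B'" "t \<in> carrier (tensor_module k M N)"
    and "\<And>x y. x \<in> carrier M \<Longrightarrow> y \<in> carrier N \<Longrightarrow> B x y \<in> carrier (tensor_module k K L)"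
    and "module k K" "module k L" "module k M" "module k N" "module k Q"
  shows "sweedler Q (sweedler (tensor_module k K L) t B) B' = sweedler Q t (\<lambda>x y. sweedler Q (B x y) B')"
  by (rule linear_map_sweedler[where f = "\<lambda>s. sweedler Q s B'"]
      linear_map_sweedler_arg linear_map_id module_tensor_module assms | assumption)+

text \<open>The substitution rule of the calculus: a tensor given by a Sweedler formula is plugged
  into a bilinear kernel. Read backwards, it folds such a formula up again.\<close>

lemma sweedler_sweedler_ptens:
  assumes "bilinear_map k K L Q B'" "t \<in> carrier (tensor_module k M N)"
    and "\<And>x y. x \<in> carrier M \<Longrightarrow> y \<in> carrier N \<Longrightarrow> f x y \<in> carrier K"
    and "\<And>x y. x \<in> carrier M \<Longrightarrow> y \<in> carrier N \<Longrightarrow> g x y \<in> carrier L"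
    and "module k K" "module k L" "module k M" "module k N" "module k Q"
  shows "sweedler Q (sweedler (tensor_module k K L) t (\<lambda>x y. ptens k K L (f x y) (g x y))) B' =
    sweedler Q t (\<lambda>x y. B' (f x y) (g x y))"
proof -
  have "sweedler Q (sweedler (tensor_module k K L) t (\<lambda>x y. ptens k K L (f x y) (g x y))) B' =
      sweedler Q t (\<lambda>x y. sweedler Q (ptens k K L (f x y) (g x y)) B')"
    by (rule sweedler_sweedler bilinear_map_closed[OF bilinear_map_ptens] assms | assumption)+
  also have "\<dots> = sweedler Q t (\<lambda>x y. B' (f x y) (g x y))"
    by (rule sweedler_cong sweedler_ptens assms | assumption)+
  finally show ?thesis .
qed

lemma sweedler_ptens_id:
  assumes "t \<in> carrier (tensor_module k M N)" "module k M" "module k N"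
  shows "sweedler (tensor_module k M N) t (ptens k M N) = t"
proof -
  note T = module_tensor_module[OF assms(2,3)]
  note bil = bilinear_map_ptens[OF assms(2,3)]
  show ?thesis
    using tensor_module_ext[OF assms(2,3) T linear_map_sweedler_arg[OF linear_map_id bil assms(2,3) T]
        linear_map_id sweedler_ptens[OF bil assms(2,3) T] assms(1)] .
qed

section \<open>Objects with automorphism\<close>

lemma und_tens [simp]: "und (tens k X Y) = tensor_module k (und X) (und Y)"
  by (simp add: tens_def)

lemma is_hom_objD:
  assumes "is_hom_obj k X"
  shows is_hom_obj_module: "module k (und X)"
    and aut_linear: "linear_map k Z (und X) f \<Longrightarrow> linear_map k Z (und X) (\<lambda>z. aut X (f z))"
    and aut_closed: "x \<in> elts X \<Longrightarrow> aut X x \<in> elts X"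
    and aut_inv_closed: "x \<in> elts X \<Longrightarrow> aut_inv X x \<in> elts X"
    and aut_aut_inv: "x \<in> elts X \<Longrightarrow> aut X (aut_inv X x) = x"
    and aut_inv_aut: "x \<in> elts X \<Longrightarrow> aut_inv X (aut X x) = x"
    and aut_inv_linear: "linear_map k Z (und X) f \<Longrightarrow> linear_map k Z (und X) (\<lambda>z. aut_inv X (f z))"
proof -
  show m: "module k (und X)" using assms by (simp add: is_hom_obj_def)
  have lin: "linear_map k (und X) (und X) (aut X)" and bij: "bij_betw (aut X) (elts X) (elts X)"
    using assms by (simp_all add: is_hom_obj_def)
  show "linear_map k Z (und X) f \<Longrightarrow> linear_map k Z (und X) (\<lambda>z. aut X (f z))"
    by (rule linear_map_comp[OF lin])
  show closed: "aut X x \<in> elts X" if "x \<in> elts X" for x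
    using that lin by (rule linear_map_closed[rotated])
  show inv_closed: "aut_inv X x \<in> elts X" if "x \<in> elts X" for x
    using that bij by (auto simp: aut_inv_def bij_betw_def intro: inv_into_into)
  show aut_inv: "aut X (aut_inv X x) = x" if "x \<in> elts X" for x
    using that bij by (auto simp: aut_inv_def bij_betw_def intro: f_inv_into_f)
  show inv_aut: "aut_inv X (aut X x) = x" if "x \<in> elts X" for x
    using that bij by (auto simp: aut_inv_def bij_betw_def)
  interpret module k "und X" by (rule m)
  have "linear_map k (und X) (und X) (aut_inv X)"
  proof (rule linear_mapI)
    fix x y assume xy: "x \<in> elts X" "y \<in> elts X"
    have "aut_inv X (aut X (aut_inv X x \<oplus>\<^bsub>und X\<^esub> aut_inv X y)) = aut_inv X x \<oplus>\<^bsub>und X\<^esub> aut_inv X y"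
      using xy by (intro inv_aut) (simp add: inv_closed)
    then show "aut_inv X (x \<oplus>\<^bsub>und X\<^esub> y) = aut_inv X x \<oplus>\<^bsub>und X\<^esub> aut_inv X y"
      using xy by (simp add: linear_map_add[OF lin] inv_closed aut_inv)
  next
    fix r x assume rx: "r \<in> carrier k" "x \<in> elts X"
    have "aut_inv X (aut X (r \<odot>\<^bsub>und X\<^esub> aut_inv X x)) = r \<odot>\<^bsub>und X\<^esub> aut_inv X x"
      using rx by (intro inv_aut) (simp add: inv_closed)
    then show "aut_inv X (r \<odot>\<^bsub>und X\<^esub> x) = r \<odot>\<^bsub>und X\<^esub> aut_inv X x"
      using rx by (simp add: linear_map_smult[OF lin] inv_closed aut_inv)
  qed (rule inv_closed)
  then show "linear_map k Z (und X) f \<Longrightarrow> linear_map k Z (und X) (\<lambda>z. aut_inv X (f z))"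
    by (rule linear_map_comp)
qed

lemma linear_map_ptens_left:
  "linear_map k X M f \<Longrightarrow> y \<in> carrier N \<Longrightarrow> module k M \<Longrightarrow> module k N \<Longrightarrow>
    linear_map k X (tensor_module k M N) (\<lambda>x. ptens k M N (f x) y)"
  by (rule bilinear_map_left[OF bilinear_map_ptens])

lemma linear_map_ptens_right:
  "linear_map k X N f \<Longrightarrow> x \<in> carrier M \<Longrightarrow> module k M \<Longrightarrow> module k N \<Longrightarrow>
    linear_map k X (tensor_module k M N) (\<lambda>y. ptens k M N x (f y))"
  by (rule bilinear_map_right[OF bilinear_map_ptens])

lemma ptens_closed:
  "x \<in> carrier M \<Longrightarrow> y \<in> carrier N \<Longrightarrow> module k M \<Longrightarrow> module k N \<Longrightarrow>
    ptens k M N x y \<in> carrier (tensor_module k M N)"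
  by (rule bilinear_map_closed[OF bilinear_map_ptens])

text \<open>Syntax-directed rules: (rule tensor_typing | assumption)+ proves closedness and multilinearity of
  Sweedler expressions. The order of the premises matters, as the first ones instantiate the modules
  that the conclusion does not mention.\<close>

lemmas tensor_typing =
  linear_map_id linear_map_ptens_left linear_map_ptens_right ptens_closed bilinear_mapI trilinear_mapI
  linear_map_sweedler_arg linear_map_sweedler_body sweedler_closed module_tensor_module

lemma
  assumes X: "is_hom_obj k X" and Y: "is_hom_obj k Y"
  shows aut_tens_ptens: "x \<in> elts X \<Longrightarrow> y \<in> elts Y \<Longrightarrow>
      aut (tens k X Y) (ptens k (und X) (und Y) x y) = ptens k (und X) (und Y) (aut X x) (aut Y y)"
    and is_hom_obj_tens: "is_hom_obj k (tens k X Y)"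
    and aut_inv_tens_ptens: "x \<in> elts X \<Longrightarrow> y \<in> elts Y \<Longrightarrow>
      aut_inv (tens k X Y) (ptens k (und X) (und Y) x y) = ptens k (und X) (und Y) (aut_inv X x) (aut_inv Y y)"
proof -
  let ?T = "tensor_module k (und X) (und Y)" and ?t = "ptens k (und X) (und Y)"
  note typing = tensor_typing is_hom_objD[OF X] is_hom_objD[OF Y]
  have bil: "bilinear_map k (und X) (und Y) ?T (\<lambda>x y. ?t (aut X x) (aut Y y))"
    by (rule typing | assumption)+
  have bil': "bilinear_map k (und X) (und Y) ?T (\<lambda>x y. ?t (aut_inv X x) (aut_inv Y y))"
    by (rule typing | assumption)+
  \<comment> \<open>\<open>aut_inv\<close> is an \<open>inv_into\<close>, so its values cannot be
    computed directly. The map induced by the two inverse automorphisms is shown on pure tensors to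
    be a two-sided inverse; bijectivity and the formula for \<open>aut_inv\<close> follow from
    it.\<close>
  define g where "g t = sweedler ?T t (\<lambda>x y. ?t (aut_inv X x) (aut_inv Y y))" for t
  have g: "linear_map k ?T ?T (\<lambda>z. g (f z))" if "linear_map k ?T ?T f" for f
    unfolding g_def by (rule linear_map_sweedler_arg[OF _ bil'] that typing | assumption)+
  have a: "linear_map k ?T ?T (\<lambda>z. aut (tens k X Y) (f z))" if "linear_map k ?T ?T f" for f
    unfolding tens_def hom_obj.simps
    by (rule linear_map_sweedler_arg[OF _ bil] that typing | assumption)+
  show a_t: "aut (tens k X Y) (?t x y) = ?t (aut X x) (aut Y y)" if "x \<in> elts X" "y \<in> elts Y" for x y
    unfolding tens_def hom_obj.simps by (rule sweedler_ptens[OF bil] that typing)+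
  have g_t: "g (?t x y) = ?t (aut_inv X x) (aut_inv Y y)" if "x \<in> elts X" "y \<in> elts Y" for x y
    unfolding g_def by (rule sweedler_ptens[OF bil'] that typing)+
  have ag: "aut (tens k X Y) (g t) = t" if "t \<in> carrier ?T" for t
    by (rule tensor_module_ext[OF _ _ _ a[OF g[OF linear_map_id]] linear_map_id _ that])
      (rule typing | simp add: g_t a_t is_hom_objD[OF X] is_hom_objD[OF Y])+
  have ga: "g (aut (tens k X Y) t) = t" if "t \<in> carrier ?T" for t
    by (rule tensor_module_ext[OF _ _ _ g[OF a[OF linear_map_id]] linear_map_id _ that])
      (rule typing | simp add: g_t a_t is_hom_objD[OF X] is_hom_objD[OF Y])+
  have bij: "bij_betw (aut (tens k X Y)) (carrier ?T) (carrier ?T)"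
    by (rule bij_betw_byWitness[where f' = g])
      (auto simp: ag ga intro: linear_map_closed[OF g[OF linear_map_id]] linear_map_closed[OF a[OF linear_map_id]])
  show obj: "is_hom_obj k (tens k X Y)"
    using bij a[OF linear_map_id] typing by (auto simp: is_hom_obj_def)
  show "aut_inv (tens k X Y) (?t x y) = ?t (aut_inv X x) (aut_inv Y y)" if xy: "x \<in> elts X" "y \<in> elts Y" for x y
  proof -
    have t: "?t x y \<in> carrier ?T" by (rule typing xy)+
    have "aut_inv (tens k X Y) (aut (tens k X Y) (g (?t x y))) = g (?t x y)"
      using linear_map_closed[OF g[OF linear_map_id] t] by (intro aut_inv_aut[OF obj]) simp
    then show ?thesis unfolding ag[OF t] unfolding g_t[OF xy] .
  qed
qed

section \<open>Products, actions and coassociativity in multilinear form\<close>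

lemma is_hom_algD:
  assumes "is_hom_alg k A"
  shows is_hom_alg_obj: "is_hom_obj k A"
    and amul_bilinear: "bilinear_map k (und A) (und A) (und A) (amul k A)"
    and unit_elt_closed: "unit_elt A \<in> elts A"
proof -
  show obj: "is_hom_obj k A" and "unit_elt A \<in> elts A"
    using assms by (auto simp: is_hom_alg_def)
  have "linear_map k (tensor_module k (und A) (und A)) (und A) (mult_map A)"
    using assms by (auto simp: is_hom_alg_def)
  note mult = linear_map_comp[OF this]
  show "bilinear_map k (und A) (und A) (und A) (amul k A)"
    unfolding amul_def by (rule mult tensor_typing is_hom_objD[OF obj] | assumption)+
qed

lemma dot_bilinear:
  assumes "is_hom_module k A M f" "is_hom_obj k A"
  shows "bilinear_map k (und M) (und A) (und M) (dot k M A f)"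
proof -
  have "linear_map k (tensor_module k (und M) (und A)) (und M) f"
    using assms by (auto simp: is_hom_module_def)
  note act = linear_map_comp[OF this]
  have "is_hom_obj k M" using assms by (auto simp: is_hom_module_def)
  note typing = act tensor_typing is_hom_objD[OF this] is_hom_objD[OF assms(2)]
  show ?thesis
    unfolding dot_def by (rule typing | assumption)+
qed

text \<open>The axiom equates two elements of M \<otimes> (C \<otimes> C). Applying the linear map
  \<open>sweedler3 P T\<close> to both sides and pushing it inside the sums leaves T evaluated at
  the three legs.\<close>

lemma hom_comodule_coassoc:
  assumes M: "is_hom_comodule k C M \<rho>" and C: "is_hom_coalg k C" and m: "m \<in> elts M"
    and T: "trilinear_map k (und M) (und C) (und C) P T" and P: "module k P"
  shows "sweedler P (\<rho> m) (\<lambda>m0 m1. sweedler P (\<rho> m0) (\<lambda>x y. T x y (aut_inv C m1))) =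
    sweedler P (\<rho> m) (\<lambda>m0 m1. sweedler P (comult C m1) (T (aut_inv M m0)))"
proof -
  let ?CC = "tensor_module k (und C) (und C)"
  let ?MCC = "tensor_module k (und M) ?CC"
  have objM: "is_hom_obj k M" and \<rho>: "linear_map k (und M) (tensor_module k (und M) (und C)) \<rho>"
    using M by (auto simp: is_hom_comodule_def)
  have objC: "is_hom_obj k C" and \<Delta>: "linear_map k (und C) ?CC (comult C)"
    using C by (auto simp: is_hom_coalg_def)
  note typing = tensor_typing is_hom_objD[OF objM] is_hom_objD[OF objC]
    linear_map_closed[OF \<rho>] linear_map_closed[OF \<Delta>] linear_map_comp[OF \<rho>] linear_map_comp[OF \<Delta>]
  have mods: "module k (und M)" "module k (und C)" by (rule typing)+
  note lin = linear_map_sweedler3[OF T mods(1,2,2) P]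
  note eval = sweedler3_ptens[OF T mods(1,2,2) P] sweedler3_ptens_ptens[OF T mods(1,2,2) P]
  have "sweedler3 P T (sweedler ?MCC (\<rho> m) (\<lambda>m0 m1.
        sweedler ?MCC (\<rho> m0) (\<lambda>m00 m01. ptens k (und M) ?CC m00 (ptens k (und C) (und C) m01 (aut_inv C m1)))))
      = sweedler P (\<rho> m) (\<lambda>m0 m1. sweedler3 P T
        (sweedler ?MCC (\<rho> m0) (\<lambda>m00 m01. ptens k (und M) ?CC m00 (ptens k (und C) (und C) m01 (aut_inv C m1)))))"
    by (rule linear_map_sweedler[OF lin] typing P m | assumption)+
  also have "\<dots> = sweedler P (\<rho> m) (\<lambda>m0 m1. sweedler P (\<rho> m0) (\<lambda>m00 m01.
        sweedler3 P T (ptens k (und M) ?CC m00 (ptens k (und C) (und C) m01 (aut_inv C m1)))))"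
    by (rule sweedler_cong linear_map_sweedler[OF lin] typing P m | assumption)+
  also have "\<dots> = sweedler P (\<rho> m) (\<lambda>m0 m1. sweedler P (\<rho> m0) (\<lambda>x y. T x y (aut_inv C m1)))"
    by (rule sweedler_cong eval typing m | assumption)+
  moreover have "sweedler3 P T (sweedler ?MCC (\<rho> m) (\<lambda>m0 m1. ptens k (und M) ?CC (aut_inv M m0) (comult C m1)))
      = sweedler P (\<rho> m) (\<lambda>m0 m1. sweedler3 P T (ptens k (und M) ?CC (aut_inv M m0) (comult C m1)))"
    by (rule linear_map_sweedler[OF lin] typing P m | assumption)+
  moreover have "\<dots> = sweedler P (\<rho> m) (\<lambda>m0 m1. sweedler P (comult C m1) (T (aut_inv M m0)))"
    by (rule sweedler_cong eval typing m | assumption)+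
  ultimately show ?thesis
    using M m by (simp add: is_hom_comodule_def)
qed

text \<open>Makes every comodule lemma available for \<Delta>. The only mismatch is in
  coassociativity: the coalgebra axiom expands the second leg as c21 \<otimes> c22, whereas the
  comodule axiom keeps \<Delta>(c2) whole, so the inner sum is recombined with
  \<open>sweedler_ptens_id\<close>.\<close>

lemma hom_coalg_comodule:
  assumes "is_hom_coalg k C"
  shows "is_hom_comodule k C C (comult C)"
proof -
  have C: "is_hom_obj k C" and \<Delta>: "linear_map k (und C) (tensor_module k (und C) (und C)) (comult C)"
    using assms by (auto simp: is_hom_coalg_def)
  note typing = tensor_typing is_hom_objD[OF C] linear_map_closed[OF \<Delta>]
  let ?CC = "tensor_module k (und C) (und C)"
  have "sweedler (tensor_module k (und C) ?CC) (comult C c) (\<lambda>c1 c2.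
        sweedler (tensor_module k (und C) ?CC) (comult C c2) (\<lambda>c21 c22.
          ptens k (und C) ?CC (aut_inv C c1) (ptens k (und C) (und C) c21 c22))) =
      sweedler (tensor_module k (und C) ?CC) (comult C c) (\<lambda>c1 c2.
        ptens k (und C) ?CC (aut_inv C c1) (comult C c2))" if c: "c \<in> elts C" for c
  proof (rule sweedler_cong)
    fix c1 c2 assume c12: "c1 \<in> elts C" "c2 \<in> elts C"
    have "ptens k (und C) ?CC (aut_inv C c1) (sweedler ?CC (comult C c2) (ptens k (und C) (und C))) =
      sweedler (tensor_module k (und C) ?CC) (comult C c2) (\<lambda>c21 c22.
          ptens k (und C) ?CC (aut_inv C c1) (ptens k (und C) (und C) c21 c22))"
      by (rule linear_map_sweedler[where f="ptens k (und C) ?CC (aut_inv C c1)"] typing c c12 | assumption)+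
    moreover have "sweedler ?CC (comult C c2) (ptens k (und C) (und C)) = comult C c2"
      by (rule sweedler_ptens_id typing c12)+
    ultimately show "sweedler (tensor_module k (und C) ?CC) (comult C c2) (\<lambda>c21 c22.
          ptens k (und C) ?CC (aut_inv C c1) (ptens k (und C) (und C) c21 c22)) =
        ptens k (und C) ?CC (aut_inv C c1) (comult C c2)"
      by simp
  qed (rule typing c)+
  then show ?thesis
    using assms unfolding is_hom_coalg_def is_hom_comodule_def by simp
qed

section \<open>Adjoints from couniversal arrows\<close>

text \<open>The pointwise criterion for right adjoints: each arrow F X \<rightarrow> Y factors
  uniquely through e Y. The object map is prescribed by G0 and kept in the conclusion, so explicit
  formulas on objects survive.\<close>

lemma is_right_adjoint_couniversal:
  assumes C: "is_category \<C>" and D: "is_category \<D>" and F: "is_functor \<C> \<D> F"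
    and G0: "\<And>Y. Y \<in> Ob \<D> \<Longrightarrow> G0 Y \<in> Ob \<C>"
    and e: "\<And>Y. Y \<in> Ob \<D> \<Longrightarrow> e Y \<in> Hom \<D> (obj_map F (G0 Y)) Y"
    and univ: "\<And>X Y f. X \<in> Ob \<C> \<Longrightarrow> Y \<in> Ob \<D> \<Longrightarrow> f \<in> Hom \<D> (obj_map F X) Y \<Longrightarrow>
      \<exists>!g. g \<in> Hom \<C> X (G0 Y) \<and>
        Comp \<D> (obj_map F X) (obj_map F (G0 Y)) Y (e Y) (arr_map F X (G0 Y) g) = f"
  shows "\<exists>G. is_right_adjoint \<C> \<D> F G \<and> obj_map G = G0"
proof -
  let ?F = "obj_map F" and ?f = "arr_map F"
  note Cid = C[unfolded is_category_def, THEN conjunct1, rule_format]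
    and Ccomp = C[unfolded is_category_def, THEN conjunct2, THEN conjunct1, rule_format]
  note Did = D[unfolded is_category_def, THEN conjunct1, rule_format]
    and Dcomp = D[unfolded is_category_def, THEN conjunct2, THEN conjunct1, rule_format]
    and Dunit = D[unfolded is_category_def, THEN conjunct2, THEN conjunct2, THEN conjunct1, rule_format]
    and Dassoc = D[unfolded is_category_def, THEN conjunct2, THEN conjunct2, THEN conjunct2, rule_format]
  note Fob = F[unfolded is_functor_def, THEN conjunct1, rule_format]
    and Farr = F[unfolded is_functor_def, THEN conjunct2, THEN conjunct1, rule_format]
    and Fid = F[unfolded is_functor_def, THEN conjunct2, THEN conjunct2, THEN conjunct1, rule_format]
    and Fcomp = F[unfolded is_functor_def, THEN conjunct2, THEN conjunct2, THEN conjunct2, rule_format]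
  \<comment> \<open>\<Psi> is the explicit direction of the adjunction bijection; its inverse \<Phi>
    exists by unique factorisation. Equations for \<Phi> are obtained by computing with \<Psi> and
    applying \<open>uniq\<close>.\<close>
  define \<Psi> where "\<Psi> X Y g = Comp \<D> (?F X) (?F (G0 Y)) Y (e Y) (?f X (G0 Y) g)" for X Y g
  define \<Phi> where "\<Phi> X Y f = (THE g. g \<in> Hom \<C> X (G0 Y) \<and> \<Psi> X Y g = f)" for X Y f
  \<comment> \<open>On morphisms the value is forced by naturality of e:
    \<open>arr_map G Y Y' h\<close> must be the factorisation of h after e Y through e Y'.\<close>
  define G where "G = \<lparr>obj_map = G0, arr_map = (\<lambda>Y Y' h. \<Phi> (G0 Y) Y' (Comp \<D> (?F (G0 Y)) Y Y' h (e Y)))\<rparr>"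
  have \<Phi>: "\<Phi> X Y f \<in> Hom \<C> X (G0 Y)" "\<Psi> X Y (\<Phi> X Y f) = f"
    if "X \<in> Ob \<C>" "Y \<in> Ob \<D>" "f \<in> Hom \<D> (?F X) Y" for X Y f
    using theI'[OF univ[OF that, folded \<Psi>_def]] by (auto simp: \<Phi>_def)
  have \<Psi>: "\<Psi> X Y g \<in> Hom \<D> (?F X) Y" if "X \<in> Ob \<C>" "Y \<in> Ob \<D>" "g \<in> Hom \<C> X (G0 Y)" for X Y g
    unfolding \<Psi>_def using that by (intro Dcomp[of _ "?F (G0 Y)"] Fob Farr G0 e)
  have uniq: "\<Phi> X Y f = g"
    if "X \<in> Ob \<C>" "Y \<in> Ob \<D>" "g \<in> Hom \<C> X (G0 Y)" "\<Psi> X Y g = f" for X Y f g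
    using the1_equality[OF univ[OF that(1,2) \<Psi>[OF that(1-3)], folded \<Psi>_def]] that by (auto simp: \<Phi>_def)
  have arrG: "arr_map G Y Y' h \<in> Hom \<C> (G0 Y) (G0 Y')"
    "\<Psi> (G0 Y) Y' (arr_map G Y Y' h) = Comp \<D> (?F (G0 Y)) Y Y' h (e Y)"
    if "Y \<in> Ob \<D>" "Y' \<in> Ob \<D>" "h \<in> Hom \<D> Y Y'" for Y Y' h
    using that \<Phi>[OF G0[OF that(1)] that(2) Dcomp[OF Fob[OF G0[OF that(1)]] that(1,2) e[OF that(1)] that(3)]]
    by (auto simp: G_def)
  have \<Psi>_comp: "\<Psi> X' Y (Comp \<C> X' X (G0 Y) g h) = Comp \<D> (?F X') (?F X) Y (\<Psi> X Y g) (?f X' X h)"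
    if "X \<in> Ob \<C>" "X' \<in> Ob \<C>" "Y \<in> Ob \<D>" "h \<in> Hom \<C> X' X" "g \<in> Hom \<C> X (G0 Y)" for X X' Y g h
    unfolding \<Psi>_def using that
    by (subst Fcomp[of X' X "G0 Y"]) (auto simp: G0 intro: Dassoc[symmetric] Fob Farr G0 e)
  \<comment> \<open>Naturality of \<Psi> in Y; it gives both preservation of composition by G and
    the second naturality square of \<Phi>.\<close>
  have nat: "\<Psi> X Y' (Comp \<C> X (G0 Y) (G0 Y') (arr_map G Y Y' h) g) = Comp \<D> (?F X) Y Y' h (\<Psi> X Y g)"
    if "X \<in> Ob \<C>" "Y \<in> Ob \<D>" "Y' \<in> Ob \<D>" "h \<in> Hom \<D> Y Y'" "g \<in> Hom \<C> X (G0 Y)" for X Y Y' g h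
    using that Dassoc[of "?F X" "?F (G0 Y)" Y Y' "?f X (G0 Y) g" "e Y" h]
    by (simp add: \<Psi>_comp arrG G0 e Fob Farr) (simp add: \<Psi>_def)
  have "is_functor \<D> \<C> G"
    unfolding is_functor_def
  proof (intro conjI ballI)
    fix X Y Z f g
    assume *: "X \<in> Ob \<D>" "Y \<in> Ob \<D>" "Z \<in> Ob \<D>" "f \<in> Hom \<D> X Y" "g \<in> Hom \<D> Y Z"
    have "\<Psi> (G0 X) Z (Comp \<C> (G0 X) (G0 Y) (G0 Z) (arr_map G Y Z g) (arr_map G X Y f)) =
        Comp \<D> (?F (G0 X)) Y Z g (Comp \<D> (?F (G0 X)) X Y f (e X))"
      using * by (simp add: nat arrG G0)
    also have "\<dots> = Comp \<D> (?F (G0 X)) X Z (Comp \<D> X Y Z g f) (e X)"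
      using * by (intro Dassoc[symmetric] Fob G0 e)
    finally have "\<Phi> (G0 X) Z (Comp \<D> (?F (G0 X)) X Z (Comp \<D> X Y Z g f) (e X)) =
        Comp \<C> (G0 X) (G0 Y) (G0 Z) (arr_map G Y Z g) (arr_map G X Y f)"
      using * by (intro uniq) (auto intro: Ccomp[of _ "G0 Y"] G0 arrG)
    then show "arr_map G X Z (Comp \<D> X Y Z g f) =
        Comp \<C> (obj_map G X) (obj_map G Y) (obj_map G Z) (arr_map G Y Z g) (arr_map G X Y f)"
      by (simp add: G_def)
  next
    fix X assume X: "X \<in> Ob \<D>"
    have "\<Psi> (G0 X) X (Idm \<C> (G0 X)) = Comp \<D> (?F (G0 X)) X X (Idm \<D> X) (e X)"
      using X by (simp add: \<Psi>_def Fid G0 Dunit Fob e)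
    then show "arr_map G X X (Idm \<D> X) = Idm \<C> (obj_map G X)"
      using X by (auto simp: G_def intro!: uniq G0 Cid)
  qed (use arrG G0 in \<open>auto simp: G_def\<close>)
  moreover have "bij_betw (\<Phi> X Y) (Hom \<D> (?F X) Y) (Hom \<C> X (obj_map G Y))"
    if "X \<in> Ob \<C>" "Y \<in> Ob \<D>" for X Y
    using that \<Phi> \<Psi> by (intro bij_betw_byWitness[where f' = "\<Psi> X Y"]) (auto simp: G_def intro: uniq)
  moreover have "\<Phi> X' Y (Comp \<D> (?F X') (?F X) Y f (?f X' X h)) = Comp \<C> X' X (obj_map G Y) (\<Phi> X Y f) h"
    if "X \<in> Ob \<C>" "X' \<in> Ob \<C>" "Y \<in> Ob \<D>" "h \<in> Hom \<C> X' X" "f \<in> Hom \<D> (?F X) Y" for X X' Y h f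
    using that by (intro uniq) (auto simp: G_def \<Phi> \<Psi>_comp intro: Ccomp[of _ X] G0 \<Phi>)
  moreover have "\<Phi> X Y' (Comp \<D> (?F X) Y Y' g f) =
      Comp \<C> X (obj_map G Y) (obj_map G Y') (arr_map G Y Y' g) (\<Phi> X Y f)"
    if "X \<in> Ob \<C>" "Y \<in> Ob \<D>" "Y' \<in> Ob \<D>" "g \<in> Hom \<D> Y Y'" "f \<in> Hom \<D> (?F X) Y" for X Y Y' g f
    using that nat[OF that(1-4) \<Phi>(1)[OF that(1,2,5)]] \<Phi>
    \<comment> \<open>Only the object part of G is evaluated; \<open>arr_map G\<close> stays folded
      so that the instance of \<open>nat\<close> still matches.\<close>
    by (intro uniq) (auto simp: G_def[THEN arg_cong[of _ _ obj_map]] intro: Ccomp[of _ "G0 Y"] G0 arrG)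
  ultimately have "is_right_adjoint \<C> \<D> F G"
    unfolding is_right_adjoint_def using C D F by (intro conjI exI[of _ \<Phi>]) blast+
  then show ?thesis by (intro exI[of _ G]) (simp add: G_def)
qed

section \<open>The two categories\<close>

lemma hom_obj_mor_id:
  assumes "is_hom_obj k M"
  shows "hom_obj_mor k M M (restrict (\<lambda>x. x) (elts M))"
  using linear_map_cong[OF linear_map_id is_hom_obj_module[OF assms], of "restrict (\<lambda>x. x) (elts M)"]
    aut_closed[OF assms]
  by (auto simp: hom_obj_mor_def)

lemma hom_obj_mor_comp:
  assumes "is_hom_obj k L" "hom_obj_mor k L M f" "hom_obj_mor k M N g"
  shows "hom_obj_mor k L N (compose (elts L) g f)"
proof -
  have f: "linear_map k (und L) (und M) f" and g: "linear_map k (und M) (und N) g"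
    using assms by (auto simp: hom_obj_mor_def)
  show ?thesis
    using linear_map_cong[OF linear_map_comp[OF g f] is_hom_obj_module[OF assms(1)], of "compose (elts L) g f"]
      aut_closed[OF assms(1)] linear_map_closed[OF f] assms(2,3)
    by (auto simp: hom_obj_mor_def compose_def)
qed

lemma hom_obj_mor_closed: "hom_obj_mor k M N f \<Longrightarrow> x \<in> elts M \<Longrightarrow> f x \<in> elts N"
  by (auto simp: hom_obj_mor_def linear_map_closed)

lemma is_hom_module_obj: "is_hom_module k A M f \<Longrightarrow> is_hom_obj k M"
  by (simp add: is_hom_module_def)

lemma is_hom_module_closed:
  assumes "is_hom_module k A M f" "is_hom_obj k A" "m \<in> elts M" "a \<in> elts A"
  shows "dot k M A f m a \<in> elts M"
  using bilinear_map_closed[OF dot_bilinear] assms by blast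

lemma a_linear_id:
  assumes "is_hom_module k A M (act M)" "is_hom_obj k A"
  shows "a_linear k A M M (restrict (\<lambda>x. x) (elts M))"
  using is_hom_module_closed[OF assms] by (simp add: a_linear_def)

lemma a_linear_comp:
  assumes "is_hom_module k A L (act L)" "is_hom_obj k A"
    and "hom_obj_mor k L M f" "a_linear k A L M f" "a_linear k A M N g"
  shows "a_linear k A L N (compose (elts L) g f)"
  using assms is_hom_module_closed[OF assms(1,2)]
  by (simp add: a_linear_def compose_def hom_obj_mor_closed)

text \<open>Unit and associativity laws hold as equalities of functions because morphisms are
  extensional on the carrier of their domain.\<close>

lemma is_category_hom_mod_cat:
  fixes A :: "('k, 'u, 'e) hom_alg_scheme"
  assumes "is_hom_alg k A"
  shows "is_category (hom_mod_cat k A :: (('k, 'u) hom_mod, _) cat)"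
proof -
  have A: "is_hom_obj k A" by (rule is_hom_alg_obj[OF assms])
  show ?thesis
    unfolding is_category_def hom_mod_cat_def
    using A
    by (auto simp: is_hom_module_obj hom_obj_mor_id hom_obj_mor_comp a_linear_id a_linear_comp)
      (auto simp: fun_eq_iff compose_def hom_obj_mor_closed hom_obj_mor_def extensional_def
        intro: hom_obj_mor_closed)
qed


lemma is_hom_comoduleD:
  assumes "is_hom_comodule k C M \<rho>"
  shows is_hom_comodule_obj: "is_hom_obj k M"
    and hom_coaction_linear: "linear_map k (und M) (tensor_module k (und M) (und C)) \<rho>"
  using assms by (simp_all add: is_hom_comodule_def)

lemma is_hom_coalgD:
  assumes "is_hom_coalg k C"
  shows is_hom_coalg_obj: "is_hom_obj k C"
    and comult_linear: "linear_map k (und C) (tensor_module k (und C) (und C)) (comult C)"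
    and counit_linear: "linear_map k (und C) (self_module k) (counit C)"
  using assms by (simp_all add: is_hom_coalg_def)

lemma c_colinear_id:
  assumes M: "is_hom_comodule k C M (coact M)" and C: "is_hom_obj k C"
  shows "c_colinear k C M M (restrict (\<lambda>x. x) (elts M))"
  unfolding c_colinear_def
proof
  fix m assume m: "m \<in> elts M"
  note typing = tensor_typing is_hom_obj_module[OF C] is_hom_obj_module[OF is_hom_comodule_obj[OF M]]
    linear_map_closed[OF hom_coaction_linear[OF M] m]
  have "sweedler (tensor_module k (und M) (und C)) (coact M m)
      (\<lambda>m0 m1. ptens k (und M) (und C) (restrict (\<lambda>x. x) (elts M) m0) m1) =
    sweedler (tensor_module k (und M) (und C)) (coact M m) (ptens k (und M) (und C))"
    by (rule sweedler_cong typing | simp)+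
  also have "\<dots> = coact M m"
    by (rule sweedler_ptens_id typing)+
  finally show "coact M (restrict (\<lambda>x. x) (elts M) m) = sweedler (und (tens k M C)) (coact M m)
      (\<lambda>m0 m1. ptens k (und M) (und C) (restrict (\<lambda>x. x) (elts M) m0) m1)"
    using m by simp
qed

text \<open>The colinearity formula for f is substituted into the one for g, which is legitimate
  because y \<otimes> c \<mapsto> g(y) \<otimes> c is bilinear.\<close>

lemma c_colinear_comp:
  assumes L: "is_hom_comodule k C L (coact L)" and M: "is_hom_obj k M" and N: "is_hom_obj k N"
    and C: "is_hom_obj k C"
    and f: "hom_obj_mor k L M f" and g: "hom_obj_mor k M N g"
    and fcol: "c_colinear k C L M f" and gcol: "c_colinear k C M N g"
  shows "c_colinear k C L N (compose (elts L) g f)"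
  unfolding c_colinear_def
proof
  fix x assume x: "x \<in> elts L"
  have flin: "linear_map k (und L) (und M) f" and glin: "linear_map k (und M) (und N) g"
    using f g by (simp_all add: hom_obj_mor_def)
  note typing = tensor_typing is_hom_obj_module[OF C] is_hom_obj_module[OF is_hom_comodule_obj[OF L]]
    is_hom_obj_module[OF M] is_hom_obj_module[OF N] linear_map_closed[OF hom_coaction_linear[OF L] x]
    linear_map_comp[OF flin] linear_map_comp[OF glin] linear_map_closed[OF flin] linear_map_closed[OF glin]
  let ?LC = "tensor_module k (und L) (und C)" and ?MC = "tensor_module k (und M) (und C)"
    and ?NC = "tensor_module k (und N) (und C)"
  have "coact N (g (f x)) = sweedler ?NC (coact M (f x)) (\<lambda>y c. ptens k (und N) (und C) (g y) c)"
    using gcol linear_map_closed[OF flin x] by (simp add: c_colinear_def)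
  also have "coact M (f x) = sweedler ?MC (coact L x) (\<lambda>y c. ptens k (und M) (und C) (f y) c)"
    using fcol x by (simp add: c_colinear_def)
  also have "sweedler ?NC \<dots> (\<lambda>y c. ptens k (und N) (und C) (g y) c) =
      sweedler ?NC (coact L x) (\<lambda>y c. ptens k (und N) (und C) (g (f y)) c)"
    by (rule sweedler_sweedler_ptens typing | assumption)+
  also have "\<dots> = sweedler ?NC (coact L x) (\<lambda>y c. ptens k (und N) (und C) (compose (elts L) g f y) c)"
    by (rule sweedler_cong typing | simp add: compose_def)+
  finally show "coact N (compose (elts L) g f x) = sweedler (und (tens k N C)) (coact L x)
      (\<lambda>y c. ptens k (und N) (und C) (compose (elts L) g f y) c)"
    using x by (simp add: compose_def)
qed

lemma is_doi_modD:
  assumes "is_doi_mod k A C H M"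
  shows is_doi_mod_hom_module: "is_hom_module k A M (act M)"
    and is_doi_mod_hom_comodule: "is_hom_comodule k C M (coact M)"
    and is_doi_mod_obj: "is_hom_obj k M"
  using assms by (simp_all add: is_doi_mod_def is_hom_module_def)

lemma is_category_doi_mod_cat:
  assumes "is_hom_alg k A" "is_hom_coalg k C"
  shows "is_category (doi_mod_cat k H A C)"
proof -
  have A: "is_hom_obj k A" by (rule is_hom_alg_obj[OF assms(1)])
  have C: "is_hom_obj k C" by (rule is_hom_coalg_obj[OF assms(2)])
  show ?thesis
    unfolding is_category_def doi_mod_cat_def
    using A C
    by (auto simp: is_doi_modD hom_obj_mor_id hom_obj_mor_comp a_linear_id a_linear_comp c_colinear_id
        intro: c_colinear_comp is_doi_modD)
      (auto simp: fun_eq_iff compose_def hom_obj_mor_closed hom_obj_mor_def extensional_def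
        intro: hom_obj_mor_closed)
qed

section \<open>The forgetful functor as truncation of records\<close>

lemma truncate_simps [simp]:
  "und (hom_mod.truncate X) = und X" "aut (hom_mod.truncate X) = aut X" "act (hom_mod.truncate X) = act X"
  by (simp_all add: hom_mod.defs)

lemma is_hom_obj_truncate [simp]: "is_hom_obj k (hom_mod.truncate X) = is_hom_obj k X"
  by (simp add: is_hom_obj_def)

lemma dot_truncate [simp]: "dot k (hom_mod.truncate X) = dot k X"
  by (simp add: dot_def fun_eq_iff)

lemma is_hom_module_truncate [simp]:
  "is_hom_module k A (hom_mod.truncate X) f = is_hom_module k A X f"
  by (simp add: is_hom_module_def)

lemma hom_obj_mor_truncate [simp]:
  "hom_obj_mor k (hom_mod.truncate X) Y f = hom_obj_mor k X Y f"
  "hom_obj_mor k X (hom_mod.truncate Y) f = hom_obj_mor k X Y f"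
  by (simp_all add: hom_obj_mor_def)

lemma a_linear_truncate [simp]:
  "a_linear k A (hom_mod.truncate X) Y f = a_linear k A X Y f"
  "a_linear k A X (hom_mod.truncate Y) f = a_linear k A X Y f"
  by (simp_all add: a_linear_def)

lemma is_functor_forget: "is_functor (doi_mod_cat k H A C) (hom_mod_cat k A) forget"
  by (simp add: is_functor_def doi_mod_cat_def hom_mod_cat_def forget_def is_doi_modD)

section \<open>Structure maps under multilinear kernels\<close>

lemma hom_comodule_aut:
  assumes M: "is_hom_comodule k C M \<rho>" and C: "is_hom_obj k C" and m: "m \<in> elts M"
    and B: "bilinear_map k (und M) (und C) P B" and P: "module k P"
  shows "sweedler P (\<rho> (aut M m)) B = sweedler P (\<rho> m) (\<lambda>m0 m1. B (aut M m0) (aut C m1))"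
proof -
  note typing = aut_closed[OF C] aut_closed[OF is_hom_comodule_obj[OF M]] is_hom_obj_module[OF C]
    is_hom_obj_module[OF is_hom_comodule_obj[OF M]] linear_map_closed[OF hom_coaction_linear[OF M] m] P
  have "\<rho> (aut M m) = sweedler (tensor_module k (und M) (und C)) (\<rho> m)
      (\<lambda>m0 m1. ptens k (und M) (und C) (aut M m0) (aut C m1))"
    using M m by (simp add: is_hom_comodule_def)
  then show ?thesis
    by simp (rule sweedler_sweedler_ptens[OF B] typing | assumption)+
qed

text \<open>The linear map f stands for the surrounding expression, so that the counit can be
  cancelled in place.\<close>

lemma hom_comodule_counit:
  assumes M: "is_hom_comodule k C M \<rho>" and C: "is_hom_coalg k C" and m: "m \<in> elts M"
    and f: "linear_map k (und M) P f" and P: "module k P"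
  shows "sweedler P (\<rho> m) (\<lambda>m0 m1. counit C m1 \<odot>\<^bsub>P\<^esub> f m0) = f (aut_inv M m)"
proof -
  have obj: "is_hom_obj k M" by (rule is_hom_comodule_obj[OF M])
  interpret M: module k "und M" by (rule is_hom_obj_module[OF obj])
  note typing = is_hom_obj_module[OF is_hom_coalg_obj[OF C]]
    is_hom_obj_module[OF obj] linear_map_closed[OF hom_coaction_linear[OF M] m] P
  have \<epsilon>: "counit C c \<in> carrier k" if "c \<in> elts C" for c
    using linear_map_closed[OF counit_linear[OF C] that] by (simp add: self_module_def ring.defs)
  have "aut_inv M m = sweedler (und M) (\<rho> m) (\<lambda>m0 m1. counit C m1 \<odot>\<^bsub>und M\<^esub> m0)"
    using M m by (simp add: is_hom_comodule_def)
  also have "f \<dots> = sweedler P (\<rho> m) (\<lambda>m0 m1. f (counit C m1 \<odot>\<^bsub>und M\<^esub> m0))"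
    by (rule linear_map_sweedler[OF f] typing M.smult_closed \<epsilon> | assumption)+
  also have "\<dots> = sweedler P (\<rho> m) (\<lambda>m0 m1. counit C m1 \<odot>\<^bsub>P\<^esub> f m0)"
    by (rule sweedler_cong linear_map_smult[OF f] \<epsilon> typing | assumption)+
  finally show ?thesis by simp
qed

text \<open>A comodule has a counit law on one side only, so the law for \<epsilon>(c1) c2 does not
  arise from viewing C as a comodule over itself and is derived separately.\<close>

lemma hom_coalg_counit_left:
  assumes C: "is_hom_coalg k C" and c: "c \<in> elts C"
    and f: "linear_map k (und C) P f" and P: "module k P"
  shows "sweedler P (comult C c) (\<lambda>c1 c2. counit C c1 \<odot>\<^bsub>P\<^esub> f c2) = f (aut_inv C c)"
proof -
  have obj: "is_hom_obj k C" by (rule is_hom_coalg_obj[OF C])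
  interpret C: module k "und C" by (rule is_hom_obj_module[OF obj])
  note typing = is_hom_obj_module[OF obj] linear_map_closed[OF comult_linear[OF C] c] P
  have \<epsilon>: "counit C c \<in> carrier k" if "c \<in> elts C" for c
    using linear_map_closed[OF counit_linear[OF C] that] by (simp add: self_module_def ring.defs)
  have "aut_inv C c = sweedler (und C) (comult C c) (\<lambda>c1 c2. counit C c1 \<odot>\<^bsub>und C\<^esub> c2)"
    using C c by (simp add: is_hom_coalg_def)
  also have "f \<dots> = sweedler P (comult C c) (\<lambda>c1 c2. f (counit C c1 \<odot>\<^bsub>und C\<^esub> c2))"
    by (rule linear_map_sweedler[OF f] typing C.smult_closed \<epsilon> | assumption)+
  also have "\<dots> = sweedler P (comult C c) (\<lambda>c1 c2. counit C c1 \<odot>\<^bsub>P\<^esub> f c2)"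
    by (rule sweedler_cong linear_map_smult[OF f] \<epsilon> typing | assumption)+
  finally show ?thesis by simp
qed

text \<open>The right-hand sides of the compatibility axioms of comodule algebras, module coalgebras and
  Doi Hom-Hopf modules all have the shape of the inner term.\<close>

lemma sweedler_sweedler2_ptens:
  assumes "bilinear_map k K L Q B"
    and "s \<in> carrier (tensor_module k M N)" "t \<in> carrier (tensor_module k M' N')"
    and "\<And>x u. x \<in> carrier M \<Longrightarrow> u \<in> carrier M' \<Longrightarrow> f x u \<in> carrier K"
    and "\<And>y v. y \<in> carrier N \<Longrightarrow> v \<in> carrier N' \<Longrightarrow> g y v \<in> carrier L"
    and "module k K" "module k L" "module k M" "module k N" "module k M'" "module k N'" "module k Q"
  shows "sweedler Q (sweedler (tensor_module k K L) s (\<lambda>x y.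
      sweedler (tensor_module k K L) t (\<lambda>u v. ptens k K L (f x u) (g y v)))) B =
    sweedler Q s (\<lambda>x y. sweedler Q t (\<lambda>u v. B (f x u) (g y v)))"
proof -
  have "sweedler Q (sweedler (tensor_module k K L) s (\<lambda>x y.
      sweedler (tensor_module k K L) t (\<lambda>u v. ptens k K L (f x u) (g y v)))) B =
    sweedler Q s (\<lambda>x y. sweedler Q (sweedler (tensor_module k K L) t (\<lambda>u v. ptens k K L (f x u) (g y v))) B)"
    by (rule sweedler_sweedler assms sweedler_closed ptens_closed module_tensor_module | assumption)+
  also have "\<dots> = sweedler Q s (\<lambda>x y. sweedler Q t (\<lambda>u v. B (f x u) (g y v)))"
    by (rule sweedler_cong sweedler_sweedler_ptens assms | assumption)+
  finally show ?thesis .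
qed

section \<open>The cofree Doi Hom-Hopf module\<close>

locale doi_datum =
  fixes k :: "'k ring"
    and H :: "('k, 'u) hom_bialg" and A :: "('k, 'u) comodule_alg" and C :: "('k, 'u) module_coalg"
  assumes datum: "doi_hom_hopf_datum k H A C"
begin

abbreviation dotC where "dotC \<equiv> dot k C H (action C)"

lemma H_alg: "is_hom_alg k H" and H_coalg: "is_hom_coalg k (coalg_of H)"
  and A_alg: "is_hom_alg k A" and A_comodule: "is_hom_comodule k (coalg_of H) A (coaction A)"
  and C_coalg: "is_hom_coalg k C" and C_module: "is_hom_module k H C (action C)"
  using datum
  by (simp_all add: doi_hom_hopf_datum_def is_hom_hopf_alg_def is_hom_bialg_def is_comodule_alg_def
      is_module_coalg_def)

lemmas H_obj = is_hom_alg_obj[OF H_alg]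
lemmas A_obj = is_hom_alg_obj[OF A_alg]
lemmas C_obj = is_hom_coalg_obj[OF C_coalg]

lemma coalg_of_simps [simp]:
  "und (coalg_of H) = und H" "aut (coalg_of H) = aut H" "aut_inv (coalg_of H) = aut_inv H"
  "comult (coalg_of H) = bi_comult H" "counit (coalg_of H) = bi_counit H"
  by (simp_all add: coalg_of_def aut_inv_def)

lemma coalg_of_obj: "is_hom_obj k (coalg_of H)"
  by (rule is_hom_coalg_obj[OF H_coalg])

lemmas mods = is_hom_obj_module[OF H_obj] is_hom_obj_module[OF A_obj] is_hom_obj_module[OF C_obj]

lemmas coaction_linear = hom_coaction_linear[OF A_comodule, simplified]
lemmas bi_comult_linear = comult_linear[OF H_coalg, simplified]

lemmas dotC_bilinear = dot_bilinear[OF C_module H_obj]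

lemma counit_closed: "c \<in> elts C \<Longrightarrow> counit C c \<in> carrier k"
  using linear_map_closed[OF counit_linear[OF C_coalg]] by (simp add: self_module_def ring.defs)

lemma bi_counit_closed: "h \<in> elts H \<Longrightarrow> bi_counit H h \<in> carrier k"
  using linear_map_closed[OF counit_linear[OF H_coalg]] by (simp add: self_module_def ring.defs)

lemmas closed = aut_closed[OF H_obj] aut_closed[OF A_obj] aut_closed[OF C_obj]
  aut_inv_closed[OF H_obj] aut_inv_closed[OF A_obj] aut_inv_closed[OF C_obj]
  bilinear_map_closed[OF dotC_bilinear]
  bilinear_map_closed[OF amul_bilinear[OF H_alg]] bilinear_map_closed[OF amul_bilinear[OF A_alg]]
  unit_elt_closed[OF H_alg] unit_elt_closed[OF A_alg] counit_closed bi_counit_closed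

lemmas typing = tensor_typing mods closed
  aut_linear[OF H_obj] aut_linear[OF A_obj] aut_linear[OF C_obj]
  aut_inv_linear[OF H_obj] aut_inv_linear[OF A_obj] aut_inv_linear[OF C_obj]
  linear_map_comp[OF coaction_linear] linear_map_closed[OF coaction_linear]
  linear_map_comp[OF bi_comult_linear] linear_map_closed[OF bi_comult_linear]
  linear_map_comp[OF comult_linear[OF C_coalg]] linear_map_closed[OF comult_linear[OF C_coalg]]
  bilinear_map_left[OF dotC_bilinear] bilinear_map_right[OF dotC_bilinear]
  bilinear_map_left[OF amul_bilinear[OF H_alg]] bilinear_map_right[OF amul_bilinear[OF H_alg]]
  bilinear_map_left[OF amul_bilinear[OF A_alg]] bilinear_map_right[OF amul_bilinear[OF A_alg]]
  linear_map_comp[OF counit_linear[OF C_coalg]]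

lemmas coaction_aut = hom_comodule_aut[OF A_comodule coalg_of_obj, simplified]
lemmas coaction_counit = hom_comodule_counit[OF A_comodule H_coalg, simplified]
lemmas coaction_coassoc = hom_comodule_coassoc[OF A_comodule H_coalg, simplified]
text \<open>Here \<Delta> is treated as the coaction of C on itself, so the comodule lemmas serve
  both \<Delta> and the coaction of A.\<close>

lemmas comult_aut = hom_comodule_aut[OF hom_coalg_comodule[OF C_coalg] C_obj]
lemmas comult_counit_right = hom_comodule_counit[OF hom_coalg_comodule[OF C_coalg] C_coalg]
lemmas comult_counit_left = hom_coalg_counit_left[OF C_coalg]
lemmas comult_coassoc = hom_comodule_coassoc[OF hom_coalg_comodule[OF C_coalg] C_coalg]

lemma coaction_mult:
  assumes "a \<in> elts A" "b \<in> elts A" "bilinear_map k (und A) (und H) P B" "module k P"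
  shows "sweedler P (coaction A (amul k A a b)) B = sweedler P (coaction A a) (\<lambda>a0 a1.
    sweedler P (coaction A b) (\<lambda>b0 b1. B (amul k A a0 b0) (amul k H a1 b1)))"
proof -
  have "coaction A (amul k A a b) = sweedler (tensor_module k (und A) (und H)) (coaction A a) (\<lambda>a0 a1.
      sweedler (tensor_module k (und A) (und H)) (coaction A b) (\<lambda>b0 b1.
        ptens k (und A) (und H) (amul k A a0 b0) (amul k H a1 b1)))"
    using datum assms by (simp add: doi_hom_hopf_datum_def is_comodule_alg_def)
  then show ?thesis
    by simp (rule sweedler_sweedler2_ptens assms typing | assumption)+
qed

lemma coaction_unit:
  assumes "bilinear_map k (und A) (und H) P B" "module k P"
  shows "sweedler P (coaction A (unit_elt A)) B = B (unit_elt A) (unit_elt H)"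
proof -
  have "coaction A (unit_elt A) = ptens k (und A) (und H) (unit_elt A) (unit_elt H)"
    using datum by (simp add: doi_hom_hopf_datum_def is_comodule_alg_def)
  then show ?thesis
    by simp (rule sweedler_ptens assms typing | assumption)+
qed

lemma comult_dot:
  assumes "c \<in> elts C" "h \<in> elts H" "bilinear_map k (und C) (und C) P B" "module k P"
  shows "sweedler P (comult C (dotC c h)) B = sweedler P (comult C c) (\<lambda>c1 c2.
    sweedler P (bi_comult H h) (\<lambda>h1 h2. B (dotC c1 h1) (dotC c2 h2)))"
proof -
  have "comult C (dotC c h) = sweedler (tensor_module k (und C) (und C)) (comult C c) (\<lambda>c1 c2.
      sweedler (tensor_module k (und C) (und C)) (bi_comult H h) (\<lambda>h1 h2.
        ptens k (und C) (und C) (dotC c1 h1) (dotC c2 h2)))"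
    using datum assms by (simp add: doi_hom_hopf_datum_def is_module_coalg_def)
  then show ?thesis
    by simp (rule sweedler_sweedler2_ptens assms typing | assumption)+
qed

lemma counit_aut: "c \<in> elts C \<Longrightarrow> counit C (aut C c) = counit C c"
  using C_coalg by (simp add: is_hom_coalg_def)

lemma counit_dot: "c \<in> elts C \<Longrightarrow> h \<in> elts H \<Longrightarrow> counit C (dotC c h) = counit C c \<otimes>\<^bsub>k\<^esub> bi_counit H h"
  using datum by (simp add: doi_hom_hopf_datum_def is_module_coalg_def)

lemmas autC = aut_aut_inv[OF C_obj] aut_inv_aut[OF C_obj]

lemma dotC_simps:
  "c \<in> elts C \<Longrightarrow> h \<in> elts H \<Longrightarrow> aut C (dotC c h) = dotC (aut C c) (aut H h)"
  "c \<in> elts C \<Longrightarrow> h \<in> elts H \<Longrightarrow> h' \<in> elts H \<Longrightarrow>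
    dotC (dotC c h) (aut H h') = dotC (aut C c) (amul k H h h')"
  "c \<in> elts C \<Longrightarrow> dotC c (unit_elt H) = aut C c"
  using C_module by (simp_all add: is_hom_module_def)

end

section \<open>The Doi Hom-Hopf structure on M \<otimes> C\<close>

locale doi_cofree = doi_datum k H A C
  for k :: "'k ring"
    and H :: "('k, 'u) hom_bialg" and A :: "('k, 'u) comodule_alg" and C :: "('k, 'u) module_coalg" +
  fixes M :: "('k, 'u) hom_mod"
  assumes M_module: "is_hom_module k A M (act M)"
begin

lemmas M_obj = is_hom_module_obj[OF M_module]
lemmas M_mod = is_hom_obj_module[OF M_obj]

abbreviation dotM where "dotM \<equiv> dot k M A (act M)"
abbreviation MC where "MC \<equiv> tensor_module k (und M) (und C)"
abbreviation MCC where "MCC \<equiv> tensor_module k MC (und C)"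
abbreviation pt where "pt \<equiv> ptens k (und M) (und C)"
abbreviation pt2 where "pt2 \<equiv> ptens k MC (und C)"

lemmas dotM_bilinear = dot_bilinear[OF M_module A_obj]

lemmas M_closed = aut_closed[OF M_obj] aut_inv_closed[OF M_obj] bilinear_map_closed[OF dotM_bilinear]

lemmas M_typing = M_mod M_closed aut_linear[OF M_obj] aut_inv_linear[OF M_obj]
  bilinear_map_left[OF dotM_bilinear] bilinear_map_right[OF dotM_bilinear]

lemmas autM = aut_aut_inv[OF M_obj] aut_inv_aut[OF M_obj]

lemma dotM_simps:
  "m \<in> elts M \<Longrightarrow> a \<in> elts A \<Longrightarrow> aut M (dotM m a) = dotM (aut M m) (aut A a)"
  "m \<in> elts M \<Longrightarrow> a \<in> elts A \<Longrightarrow> b \<in> elts A \<Longrightarrow>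
    dotM (dotM m a) (aut A b) = dotM (aut M m) (amul k A a b)"
  "m \<in> elts M \<Longrightarrow> dotM m (unit_elt A) = aut M m"
  using M_module by (simp_all add: is_hom_module_def)

text \<open>The coaction of M \<otimes> C applies \<mu>^-1 to m \<cdot> a0; moving it onto a0
  produces the \<beta>^-1(a0) that coassociativity of the coaction of A expects.\<close>

lemma aut_inv_dotM:
  assumes "m \<in> elts M" "a \<in> elts A"
  shows "aut_inv M (dotM m a) = dotM (aut_inv M m) (aut_inv A a)"
proof -
  have "aut_inv M (aut M (dotM (aut_inv M m) (aut_inv A a))) = dotM (aut_inv M m) (aut_inv A a)"
    using assms by (simp add: autM closed M_closed)
  then show ?thesis
    using assms by (simp add: dotM_simps autM aut_aut_inv[OF A_obj] closed M_closed)
qed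

definition cofree_dot where
  "cofree_dot t a = sweedler MC t (\<lambda>m c. sweedler MC (coaction A a) (\<lambda>a0 a1.
    ptens k (und M) (und C) (dotM m a0) (dotC c a1)))"

text \<open>M \<otimes> \<Delta> followed by the inverse associator: this is where \<mu>^-1 on the
  first leg and \<gamma> on the last come from.\<close>

definition cofree_coact where
  "cofree_coact t = sweedler MCC t (\<lambda>m c. sweedler MCC (comult C c) (\<lambda>c1 c2.
    ptens k MC (und C) (ptens k (und M) (und C) (aut_inv M m) c1) (aut C c2)))"

text \<open>An action is a map on (M \<otimes> C) \<otimes> A, so the two-argument
  \<open>cofree_dot\<close> is extended from pure tensors by \<open>sweedler\<close>;
  \<open>dot_cofree\<close> recovers it.\<close>

definition cofree where
  "cofree = \<lparr>und = MC, aut = aut (tens k M C), act = (\<lambda>s. sweedler MC s cofree_dot), coact = cofree_coact\<rparr>"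

text \<open>M \<otimes> \<epsilon> followed by the right unit constraint, hence the factor
  \<mu>.\<close>

definition cofree_counit where
  "cofree_counit t = sweedler (und M) t (\<lambda>m c. counit C c \<odot>\<^bsub>und M\<^esub> aut M m)"

lemma cofree_simps [simp]:
  "und cofree = MC" "aut cofree = aut (tens k M C)" "act cofree = (\<lambda>s. sweedler MC s cofree_dot)"
  "coact cofree = cofree_coact" "hom_obj.truncate cofree = tens k M C"
  by (simp_all add: cofree_def hom_obj.defs tens_def)

lemma aut_inv_cofree [simp]: "aut_inv cofree = aut_inv (tens k M C)"
  by (simp add: aut_inv_def)

lemma cofree_obj: "is_hom_obj k cofree"
  using is_hom_obj_tens[OF M_obj C_obj] by (simp add: is_hom_obj_def)

lemmas autMC = aut_tens_ptens[OF M_obj C_obj] aut_inv_tens_ptens[OF M_obj C_obj]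

lemma smultM_typing:
  "r \<in> carrier k \<Longrightarrow> x \<in> elts M \<Longrightarrow> r \<odot>\<^bsub>und M\<^esub> x \<in> elts M"
  "linear_map k X (und M) f \<Longrightarrow> r \<in> carrier k \<Longrightarrow> linear_map k X (und M) (\<lambda>x. r \<odot>\<^bsub>und M\<^esub> f x)"
  "linear_map k X (self_module k) g \<Longrightarrow> x \<in> elts M \<Longrightarrow> linear_map k X (und M) (\<lambda>z. g z \<odot>\<^bsub>und M\<^esub> x)"
  using linear_map_smult_right[OF M_mod] linear_map_smult_left[OF M_mod]
  by (auto intro: module.smult_closed[OF M_mod])

lemma autMC_typing:
  "linear_map k Z MC f \<Longrightarrow> linear_map k Z MC (\<lambda>z. aut (tens k M C) (f z))"
  "linear_map k Z MC f \<Longrightarrow> linear_map k Z MC (\<lambda>z. aut_inv (tens k M C) (f z))"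
  "t \<in> carrier MC \<Longrightarrow> aut (tens k M C) t \<in> carrier MC"
  "t \<in> carrier MC \<Longrightarrow> aut_inv (tens k M C) t \<in> carrier MC"
  using is_hom_objD[OF is_hom_obj_tens[OF M_obj C_obj]] by simp_all

lemma cofree_dot_typing:
  "linear_map k Z MC f \<Longrightarrow> a \<in> elts A \<Longrightarrow> linear_map k Z MC (\<lambda>z. cofree_dot (f z) a)"
  "linear_map k Z (und A) g \<Longrightarrow> t \<in> carrier MC \<Longrightarrow> linear_map k Z MC (\<lambda>z. cofree_dot t (g z))"
  "t \<in> carrier MC \<Longrightarrow> a \<in> elts A \<Longrightarrow> cofree_dot t a \<in> carrier MC"
  unfolding cofree_dot_def by (rule typing M_typing | assumption)+

lemma cofree_coact_typing:
  "linear_map k Z MC f \<Longrightarrow> linear_map k Z MCC (\<lambda>z. cofree_coact (f z))"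
  "t \<in> carrier MC \<Longrightarrow> cofree_coact t \<in> carrier MCC"
  unfolding cofree_coact_def by (rule typing M_typing | assumption)+

lemma cofree_counit_typing:
  "linear_map k Z MC f \<Longrightarrow> linear_map k Z (und M) (\<lambda>z. cofree_counit (f z))"
  "t \<in> carrier MC \<Longrightarrow> cofree_counit t \<in> elts M"
  unfolding cofree_counit_def by (rule typing M_typing smultM_typing | assumption)+

lemmas Typing = typing M_typing smultM_typing autMC_typing cofree_dot_typing cofree_coact_typing cofree_counit_typing

lemma cofree_dot_ptens:
  assumes "m \<in> elts M" "c \<in> elts C" "a \<in> elts A"
  shows "cofree_dot (ptens k (und M) (und C) m c) a = sweedler MC (coaction A a) (\<lambda>a0 a1.
    ptens k (und M) (und C) (dotM m a0) (dotC c a1))"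
  unfolding cofree_dot_def by (rule sweedler_ptens Typing assms | assumption)+

lemma cofree_coact_ptens:
  assumes "m \<in> elts M" "c \<in> elts C"
  shows "cofree_coact (ptens k (und M) (und C) m c) = sweedler MCC (comult C c) (\<lambda>c1 c2.
    ptens k MC (und C) (ptens k (und M) (und C) (aut_inv M m) c1) (aut C c2))"
  unfolding cofree_coact_def by (rule sweedler_ptens Typing assms | assumption)+

lemma cofree_counit_ptens:
  assumes "m \<in> elts M" "c \<in> elts C"
  shows "cofree_counit (ptens k (und M) (und C) m c) = counit C c \<odot>\<^bsub>und M\<^esub> aut M m"
  unfolding cofree_counit_def by (rule sweedler_ptens Typing assms | assumption)+

lemma act_cofree_linear: "linear_map k (tensor_module k MC (und A)) MC (act cofree)"
  unfolding cofree_simps by (rule Typing | assumption)+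

lemma dot_cofree:
  assumes "t \<in> carrier MC" "a \<in> elts A"
  shows "dot k cofree A (act cofree) t a = cofree_dot t a"
  unfolding dot_def cofree_simps by (rule sweedler_ptens Typing assms | assumption)+

lemma cofree_dot_aut:
  assumes "t \<in> carrier MC" and a: "a \<in> elts A"
  shows "aut (tens k M C) (cofree_dot t a) = cofree_dot (aut (tens k M C) t) (aut A a)"
proof (rule tensor_module_ext[of k "und M" "und C" MC "\<lambda>t. aut (tens k M C) (cofree_dot t a)"
      "\<lambda>t. cofree_dot (aut (tens k M C) t) (aut A a)"])
  fix m c assume mc: "m \<in> elts M" "c \<in> elts C"
  have "aut (tens k M C) (cofree_dot (pt m c) a) =
      aut (tens k M C) (sweedler MC (coaction A a) (\<lambda>a0 a1. pt (dotM m a0) (dotC c a1)))"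
    by (simp add: cofree_dot_ptens mc a)
  also have "\<dots> = sweedler MC (coaction A a) (\<lambda>a0 a1. aut (tens k M C) (pt (dotM m a0) (dotC c a1)))"
    by (rule linear_map_sweedler[where f = "aut (tens k M C)"] Typing mc a | assumption)+
  also have "\<dots> = sweedler MC (coaction A a) (\<lambda>a0 a1. pt (dotM (aut M m) (aut A a0)) (dotC (aut C c) (aut H a1)))"
    by (rule sweedler_cong Typing a | simp add: autMC closed M_closed mc dotM_simps dotC_simps)+
  also have "\<dots> = sweedler MC (coaction A (aut A a)) (\<lambda>a0 a1. pt (dotM (aut M m) a0) (dotC (aut C c) a1))"
    by (rule coaction_aut[symmetric] Typing mc a | assumption)+
  also have "\<dots> = cofree_dot (aut (tens k M C) (pt m c)) (aut A a)"
    by (simp add: autMC mc cofree_dot_ptens closed M_closed a)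
  finally show "aut (tens k M C) (cofree_dot (pt m c) a) = cofree_dot (aut (tens k M C) (pt m c)) (aut A a)" .
qed (rule Typing assms | assumption)+

text \<open>Associativity of the actions on M and on C is used in each leg; multiplicativity of the
  coaction of A then merges the products a0 b0 and a1 b1 into the coaction of ab.\<close>

lemma cofree_dot_assoc:
  assumes "t \<in> carrier MC" and ab: "a \<in> elts A" "b \<in> elts A"
  shows "cofree_dot (cofree_dot t a) (aut A b) = cofree_dot (aut (tens k M C) t) (amul k A a b)"
proof (rule tensor_module_ext[of k "und M" "und C" MC "\<lambda>t. cofree_dot (cofree_dot t a) (aut A b)"
      "\<lambda>t. cofree_dot (aut (tens k M C) t) (amul k A a b)"])
  fix m c assume mc: "m \<in> elts M" "c \<in> elts C"
  have "cofree_dot (cofree_dot (pt m c) a) (aut A b) =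
      cofree_dot (sweedler MC (coaction A a) (\<lambda>a0 a1. pt (dotM m a0) (dotC c a1))) (aut A b)"
    by (simp add: cofree_dot_ptens mc ab)
  also have "\<dots> = sweedler MC (coaction A a) (\<lambda>a0 a1. cofree_dot (pt (dotM m a0) (dotC c a1)) (aut A b))"
    by (rule linear_map_sweedler[where f = "\<lambda>t. cofree_dot t (aut A b)"] Typing mc ab | assumption)+
  also have "\<dots> = sweedler MC (coaction A a) (\<lambda>a0 a1. sweedler MC (coaction A (aut A b)) (\<lambda>b0 b1.
      pt (dotM (dotM m a0) b0) (dotC (dotC c a1) b1)))"
    by (rule sweedler_cong cofree_dot_ptens Typing mc ab | assumption)+
  also have "\<dots> = sweedler MC (coaction A a) (\<lambda>a0 a1. sweedler MC (coaction A b) (\<lambda>b0 b1.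
      pt (dotM (dotM m a0) (aut A b0)) (dotC (dotC c a1) (aut H b1))))"
    \<comment> \<open>The prescribed kernel restricts the congruence rule to the outer sum; on the
      inner sum the change of variables \<open>coaction_aut\<close> applies.\<close>
    by (rule coaction_aut sweedler_cong[where B = "\<lambda>a0 a1. sweedler MC (coaction A (aut A b)) (B a0 a1)" for B]
        Typing mc ab | assumption)+
  also have "\<dots> = sweedler MC (coaction A a) (\<lambda>a0 a1. sweedler MC (coaction A b) (\<lambda>b0 b1.
      pt (dotM (aut M m) (amul k A a0 b0)) (dotC (aut C c) (amul k H a1 b1))))"
    by (rule sweedler_cong Typing ab | simp add: mc dotM_simps dotC_simps)+
  also have "\<dots> = sweedler MC (coaction A (amul k A a b)) (\<lambda>a0 a1. pt (dotM (aut M m) a0) (dotC (aut C c) a1))"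
    by (rule coaction_mult[symmetric] Typing mc ab | assumption)+
  also have "\<dots> = cofree_dot (aut (tens k M C) (pt m c)) (amul k A a b)"
    by (simp add: autMC mc cofree_dot_ptens closed M_closed ab)
  finally show "cofree_dot (cofree_dot (pt m c) a) (aut A b) =
      cofree_dot (aut (tens k M C) (pt m c)) (amul k A a b)" .
qed (rule Typing assms | assumption)+

lemma cofree_dot_unit:
  assumes "t \<in> carrier MC"
  shows "cofree_dot t (unit_elt A) = aut (tens k M C) t"
proof (rule tensor_module_ext[of k "und M" "und C" MC "\<lambda>t. cofree_dot t (unit_elt A)" "aut (tens k M C)"])
  fix m c assume mc: "m \<in> elts M" "c \<in> elts C"
  have "cofree_dot (pt m c) (unit_elt A) = sweedler MC (coaction A (unit_elt A)) (\<lambda>a0 a1. pt (dotM m a0) (dotC c a1))"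
    by (simp add: cofree_dot_ptens mc closed)
  also have "\<dots> = pt (dotM m (unit_elt A)) (dotC c (unit_elt H))"
    by (rule coaction_unit Typing mc | assumption)+
  finally show "cofree_dot (pt m c) (unit_elt A) = aut (tens k M C) (pt m c)"
    by (simp add: mc dotM_simps dotC_simps autMC)
qed (rule Typing assms | assumption)+

lemma cofree_module: "is_hom_module k A cofree (act cofree)"
proof -
  have "dot k cofree A (\<lambda>s. sweedler MC s cofree_dot) = dot k cofree A (act cofree)"
    by simp
  then show ?thesis
    unfolding is_hom_module_def
    using cofree_obj act_cofree_linear
    by (simp add: dot_cofree Typing cofree_dot_aut cofree_dot_assoc cofree_dot_unit del: cofree_simps(3))
qed

lemma cofree_coact_aut:
  assumes "t \<in> carrier MC"
  shows "cofree_coact (aut (tens k M C) t) =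
    sweedler MCC (cofree_coact t) (\<lambda>s c. pt2 (aut (tens k M C) s) (aut C c))"
proof (rule tensor_module_ext[of k "und M" "und C" MCC "\<lambda>t. cofree_coact (aut (tens k M C) t)"
      "\<lambda>t. sweedler MCC (cofree_coact t) (\<lambda>s c. pt2 (aut (tens k M C) s) (aut C c))"])
  fix m c assume mc: "m \<in> elts M" "c \<in> elts C"
  have "cofree_coact (aut (tens k M C) (pt m c)) = sweedler MCC (comult C (aut C c))
      (\<lambda>c1 c2. pt2 (pt (aut_inv M (aut M m)) c1) (aut C c2))"
    by (simp add: autMC mc cofree_coact_ptens closed M_closed)
  also have "\<dots> = sweedler MCC (comult C c) (\<lambda>c1 c2. pt2 (pt (aut_inv M (aut M m)) (aut C c1)) (aut C (aut C c2)))"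
    by (rule comult_aut Typing mc | assumption)+
  also have "\<dots> = sweedler MCC (comult C c) (\<lambda>c1 c2. pt2 (aut (tens k M C) (pt (aut_inv M m) c1)) (aut C (aut C c2)))"
    by (rule sweedler_cong Typing mc | simp add: mc autMC closed M_closed autM)+
  also have "\<dots> = sweedler MCC (sweedler MCC (comult C c) (\<lambda>c1 c2. pt2 (pt (aut_inv M m) c1) (aut C c2)))
      (\<lambda>s c. pt2 (aut (tens k M C) s) (aut C c))"
    by (rule sweedler_sweedler_ptens[symmetric] Typing mc | assumption)+
  finally show "cofree_coact (aut (tens k M C) (pt m c)) =
      sweedler MCC (cofree_coact (pt m c)) (\<lambda>s c. pt2 (aut (tens k M C) s) (aut C c))"
    by (simp add: cofree_coact_ptens mc)
qed (rule Typing assms | assumption)+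

text \<open>Coacting twice puts \<mu>^-2 on m and \<gamma> on the middle leg, while \<gamma>^-1 and
  \<gamma> cancel on the last. What remains is coassociativity of C under the kernel that sends x,
  y, z to (n \<otimes> x) \<otimes> (\<gamma>(y) \<otimes> \<gamma>(z)) with n =
  \<mu>^-2(m).\<close>

lemma cofree_coact_coassoc:
  assumes "t \<in> carrier MC"
  defines "CC \<equiv> tensor_module k (und C) (und C)"
  defines "Q \<equiv> tensor_module k MC CC"
  shows "sweedler Q (cofree_coact t) (\<lambda>s c. sweedler Q (cofree_coact s) (\<lambda>s' c'.
      ptens k MC CC s' (ptens k (und C) (und C) c' (aut_inv C c)))) =
    sweedler Q (cofree_coact t) (\<lambda>s c. ptens k MC CC (aut_inv (tens k M C) s) (comult C c))"
  unfolding Q_def CC_def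
proof (rule tensor_module_ext[of k "und M" "und C" "tensor_module k MC (tensor_module k (und C) (und C))"
    "\<lambda>t. sweedler (tensor_module k MC (tensor_module k (und C) (und C))) (cofree_coact t)
      (\<lambda>s c. sweedler (tensor_module k MC (tensor_module k (und C) (und C))) (cofree_coact s) (\<lambda>s' c'.
      ptens k MC (tensor_module k (und C) (und C)) s' (ptens k (und C) (und C) c' (aut_inv C c))))"
    "\<lambda>t. sweedler (tensor_module k MC (tensor_module k (und C) (und C))) (cofree_coact t)
      (\<lambda>s c. ptens k MC (tensor_module k (und C) (und C)) (aut_inv (tens k M C) s) (comult C c))"])
  let ?CC = "tensor_module k (und C) (und C)"
  let ?Q = "tensor_module k MC ?CC"
  let ?p = "ptens k MC ?CC" and ?q = "ptens k (und C) (und C)"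
  fix m c assume mc: "m \<in> elts M" "c \<in> elts C"
  define n where "n = aut_inv M (aut_inv M m)"
  have n: "n \<in> elts M" by (simp add: n_def mc M_closed)
  have "sweedler ?Q (cofree_coact (pt m c)) (\<lambda>s c. sweedler ?Q (cofree_coact s) (\<lambda>s' c'. ?p s' (?q c' (aut_inv C c)))) =
      sweedler ?Q (comult C c) (\<lambda>c1 c2. sweedler ?Q (cofree_coact (pt (aut_inv M m) c1))
        (\<lambda>s' c'. ?p s' (?q c' (aut_inv C (aut C c2)))))"
    unfolding cofree_coact_ptens[OF mc] by (rule sweedler_sweedler_ptens Typing mc | assumption)+
  also have "\<dots> = sweedler ?Q (comult C c) (\<lambda>c1 c2. sweedler ?Q (sweedler MCC (comult C c1) (\<lambda>x y. pt2 (pt n x) (aut C y)))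
        (\<lambda>s' c'. ?p s' (?q c' c2)))"
    by (rule sweedler_cong[OF linear_map_closed[OF comult_linear[OF C_coalg]]] Typing mc
        | simp add: cofree_coact_ptens mc M_closed autC n_def)+
  also have "\<dots> = sweedler ?Q (comult C c) (\<lambda>c1 c2. sweedler ?Q (comult C c1) (\<lambda>x y. ?p (pt n x) (?q (aut C y) c2)))"
    by (rule sweedler_cong[where B = "\<lambda>x y. sweedler ?Q (sweedler MCC (F x y) (G x y)) (L x y)" for F G L]
        sweedler_sweedler_ptens Typing mc n | assumption)+
  \<comment> \<open>c2 is written as \<gamma>(\<gamma>^-1(c2)) to create the \<gamma>^-1 in the last
    leg that \<open>comult_coassoc\<close> matches.\<close>
  also have "\<dots> = sweedler ?Q (comult C c) (\<lambda>c1 c2. sweedler ?Q (comult C c1)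
      (\<lambda>x y. ?p (pt n x) (?q (aut C y) (aut C (aut_inv C c2)))))"
    by (rule sweedler_cong Typing mc n | simp add: autC)+
  also have "\<dots> = sweedler ?Q (comult C c) (\<lambda>c1 c2. sweedler ?Q (comult C c2)
      (\<lambda>y z. ?p (pt n (aut_inv C c1)) (?q (aut C y) (aut C z))))"
    by (rule comult_coassoc[where T = "\<lambda>x y z. ?p (pt n x) (?q (aut C y) (aut C z))"] Typing mc n | assumption)+
  also have "\<dots> = sweedler ?Q (comult C c) (\<lambda>c1 c2. ?p (aut_inv (tens k M C) (pt (aut_inv M m) c1)) (comult C (aut C c2)))"
  proof (rule sweedler_cong)
    fix c1 c2 assume c12: "c1 \<in> elts C" "c2 \<in> elts C"
    have "sweedler ?Q (comult C c2) (\<lambda>y z. ?p (pt n (aut_inv C c1)) (?q (aut C y) (aut C z))) =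
      sweedler ?Q (comult C (aut C c2)) (\<lambda>y z. ?p (pt n (aut_inv C c1)) (?q y z))"
      by (rule comult_aut[symmetric] Typing mc n c12 | assumption)+
    also have "\<dots> = ?p (pt n (aut_inv C c1)) (sweedler ?CC (comult C (aut C c2)) ?q)"
      by (rule linear_map_sweedler[where f = "?p (pt n (aut_inv C c1))", symmetric] Typing mc n c12 | assumption)+
    also have "sweedler ?CC (comult C (aut C c2)) ?q = comult C (aut C c2)"
      by (rule sweedler_ptens_id Typing c12)+
    finally show "sweedler ?Q (comult C c2) (\<lambda>y z. ?p (pt n (aut_inv C c1)) (?q (aut C y) (aut C z))) =
      ?p (aut_inv (tens k M C) (pt (aut_inv M m) c1)) (comult C (aut C c2))"
      by (simp add: autMC mc c12 M_closed n_def)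
  qed (rule Typing mc)+
  also have "\<dots> = sweedler ?Q (cofree_coact (pt m c)) (\<lambda>s c. ?p (aut_inv (tens k M C) s) (comult C c))"
    unfolding cofree_coact_ptens[OF mc] by (rule sweedler_sweedler_ptens[symmetric] Typing mc | assumption)+
  finally show "sweedler ?Q (cofree_coact (pt m c)) (\<lambda>s c. sweedler ?Q (cofree_coact s) (\<lambda>s' c'. ?p s' (?q c' (aut_inv C c)))) =
    sweedler ?Q (cofree_coact (pt m c)) (\<lambda>s c. ?p (aut_inv (tens k M C) s) (comult C c))" .
qed (rule Typing assms(1) | assumption)+

lemma smultMC_typing:
  "r \<in> carrier k \<Longrightarrow> x \<in> carrier MC \<Longrightarrow> r \<odot>\<^bsub>MC\<^esub> x \<in> carrier MC"
  "linear_map k X MC f \<Longrightarrow> r \<in> carrier k \<Longrightarrow> linear_map k X MC (\<lambda>x. r \<odot>\<^bsub>MC\<^esub> f x)"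
  "linear_map k X (self_module k) g \<Longrightarrow> x \<in> carrier MC \<Longrightarrow> linear_map k X MC (\<lambda>z. g z \<odot>\<^bsub>MC\<^esub> x)"
  using linear_map_smult_right[of k MC] linear_map_smult_left[of k MC]
    module_tensor_module[OF M_mod is_hom_obj_module[OF C_obj]]
  by (auto intro: module.smult_closed)

text \<open>The \<gamma> on the last leg is absorbed by \<epsilon>\<gamma> = \<epsilon>; the right
  counit law of C then leaves \<gamma>^-1(c) beside \<mu>^-1(m).\<close>

lemma cofree_coact_counit:
  assumes "t \<in> carrier MC"
  shows "sweedler MC (cofree_coact t) (\<lambda>s c. counit C c \<odot>\<^bsub>MC\<^esub> s) = aut_inv (tens k M C) t"
proof (rule tensor_module_ext[of k "und M" "und C" MC "\<lambda>t. sweedler MC (cofree_coact t) (\<lambda>s c. counit C c \<odot>\<^bsub>MC\<^esub> s)"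
    "aut_inv (tens k M C)"])
  fix m c assume mc: "m \<in> elts M" "c \<in> elts C"
  have "sweedler MC (cofree_coact (pt m c)) (\<lambda>s c. counit C c \<odot>\<^bsub>MC\<^esub> s) =
      sweedler MC (comult C c) (\<lambda>c1 c2. counit C (aut C c2) \<odot>\<^bsub>MC\<^esub> pt (aut_inv M m) c1)"
    unfolding cofree_coact_ptens[OF mc] by (rule sweedler_sweedler_ptens Typing smultMC_typing mc | assumption)+
  also have "\<dots> = sweedler MC (comult C c) (\<lambda>c1 c2. counit C c2 \<odot>\<^bsub>MC\<^esub> pt (aut_inv M m) c1)"
    by (rule sweedler_cong Typing mc | simp add: counit_aut)+
  also have "\<dots> = pt (aut_inv M m) (aut_inv C c)"
    by (rule comult_counit_right Typing mc | assumption)+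
  finally show "sweedler MC (cofree_coact (pt m c)) (\<lambda>s c. counit C c \<odot>\<^bsub>MC\<^esub> s) = aut_inv (tens k M C) (pt m c)"
    by (simp add: autMC mc)
qed (rule Typing smultMC_typing assms | assumption)+

lemma cofree_comodule: "is_hom_comodule k C cofree (coact cofree)"
  unfolding is_hom_comodule_def
  using cofree_obj cofree_coact_typing(1)[OF linear_map_id]
  by (simp add: cofree_coact_aut cofree_coact_coassoc cofree_coact_counit)

text \<open>Expanding \<Delta>(c \<cdot> a1) yields the legs \<beta>^-1(a0), a11, a12.
  Coassociativity of the coaction of A turns them into a00, a01, \<alpha>^-1(a1). The \<gamma> on
  the last leg of the coaction becomes \<alpha> on the acting element and cancels \<alpha>^-1, and
  a00, a01 reassemble to the action of a0.\<close>

lemma cofree_compatible: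
  assumes "t \<in> carrier MC" and a: "a \<in> elts A"
  shows "cofree_coact (cofree_dot t a) = sweedler MCC (cofree_coact t) (\<lambda>s c.
    sweedler MCC (coaction A a) (\<lambda>a0 a1. pt2 (cofree_dot s a0) (dotC c a1)))"
proof (rule tensor_module_ext[of k "und M" "und C" MCC "\<lambda>t. cofree_coact (cofree_dot t a)"
    "\<lambda>t. sweedler MCC (cofree_coact t) (\<lambda>s c. sweedler MCC (coaction A a) (\<lambda>a0 a1. pt2 (cofree_dot s a0) (dotC c a1)))"])
  fix m c assume mc: "m \<in> elts M" "c \<in> elts C"
  define n where "n = aut_inv M m"
  have n: "n \<in> elts M" by (simp add: n_def mc M_closed)
  have "cofree_coact (cofree_dot (pt m c) a) =
      cofree_coact (sweedler MC (coaction A a) (\<lambda>a0 a1. pt (dotM m a0) (dotC c a1)))"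
    by (simp add: cofree_dot_ptens mc a)
  also have "\<dots> = sweedler MCC (coaction A a) (\<lambda>a0 a1. cofree_coact (pt (dotM m a0) (dotC c a1)))"
    by (rule linear_map_sweedler[where f = cofree_coact] Typing mc a | assumption)+
  also have "\<dots> = sweedler MCC (coaction A a) (\<lambda>a0 a1. sweedler MCC (comult C (dotC c a1))
      (\<lambda>x y. pt2 (pt (aut_inv M (dotM m a0)) x) (aut C y)))"
    by (rule sweedler_cong cofree_coact_ptens Typing mc a | assumption)+
  also have "\<dots> = sweedler MCC (coaction A a) (\<lambda>a0 a1. sweedler MCC (comult C c) (\<lambda>c1 c2. sweedler MCC (bi_comult H a1) (\<lambda>h1 h2.
      pt2 (pt (aut_inv M (dotM m a0)) (dotC c1 h1)) (aut C (dotC c2 h2)))))"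
    by (rule comult_dot sweedler_cong[where B = "\<lambda>x y. sweedler MCC (comult C (F x y)) (G x y)" for F G]
        Typing mc a | assumption)+
  also have "\<dots> = sweedler MCC (coaction A a) (\<lambda>a0 a1. sweedler MCC (comult C c) (\<lambda>c1 c2. sweedler MCC (bi_comult H a1) (\<lambda>h1 h2.
      pt2 (pt (dotM n (aut_inv A a0)) (dotC c1 h1)) (dotC (aut C c2) (aut H h2)))))"
    by (rule sweedler_cong Typing mc a | simp add: mc aut_inv_dotM dotC_simps n_def)+
  \<comment> \<open>With the sum over c1 and c2 outermost these are fixed, and the coassociativity
    law of A can be applied to the two inner sums.\<close>
  also have "\<dots> = sweedler MCC (comult C c) (\<lambda>c1 c2. sweedler MCC (coaction A a) (\<lambda>a0 a1. sweedler MCC (bi_comult H a1) (\<lambda>h1 h2.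
      pt2 (pt (dotM n (aut_inv A a0)) (dotC c1 h1)) (dotC (aut C c2) (aut H h2)))))"
    by (rule sweedler_swap Typing mc n a | assumption)+
  also have "\<dots> = sweedler MCC (comult C c) (\<lambda>c1 c2. sweedler MCC (coaction A a) (\<lambda>a0 a1. sweedler MCC (coaction A a0) (\<lambda>x y.
      pt2 (pt (dotM n x) (dotC c1 y)) (dotC (aut C c2) (aut H (aut_inv H a1))))))"
  proof (rule sweedler_cong)
    fix c1 c2 assume c12: "c1 \<in> elts C" "c2 \<in> elts C"
    show "sweedler MCC (coaction A a) (\<lambda>a0 a1. sweedler MCC (bi_comult H a1) (\<lambda>h1 h2.
        pt2 (pt (dotM n (aut_inv A a0)) (dotC c1 h1)) (dotC (aut C c2) (aut H h2)))) =
      sweedler MCC (coaction A a) (\<lambda>a0 a1. sweedler MCC (coaction A a0) (\<lambda>x y.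
        pt2 (pt (dotM n x) (dotC c1 y)) (dotC (aut C c2) (aut H (aut_inv H a1)))))"
      by (rule coaction_coassoc[symmetric, where T = "\<lambda>x y z. pt2 (pt (dotM n x) (dotC c1 y)) (dotC (aut C c2) (aut H z))"]
          Typing n a c12 | assumption)+
  qed (rule Typing mc)+
  also have "\<dots> = sweedler MCC (comult C c) (\<lambda>c1 c2. sweedler MCC (coaction A a) (\<lambda>a0 a1. sweedler MCC (coaction A a0) (\<lambda>x y.
      pt2 (pt (dotM n x) (dotC c1 y)) (dotC (aut C c2) a1))))"
    by (rule sweedler_cong Typing mc n a | simp add: aut_aut_inv[OF H_obj])+
  \<comment> \<open>Linearity of \<open>pt2\<close> in its first slot gathers the innermost sum,
    which is the action of a0 on n \<otimes> c1.\<close>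
  also have "\<dots> = sweedler MCC (comult C c) (\<lambda>c1 c2. sweedler MCC (coaction A a) (\<lambda>a0 a1.
      pt2 (sweedler MC (coaction A a0) (\<lambda>x y. pt (dotM n x) (dotC c1 y))) (dotC (aut C c2) a1)))"
    by (rule linear_map_sweedler[where f = "\<lambda>s. pt2 s (dotC (aut C u) v)" for u v, symmetric]
        sweedler_cong[where M = "und C" and N = "und C"] sweedler_cong[where M = "und A" and N = "und H" and t = "coaction A a"]
        Typing mc n a | assumption)+
  also have "\<dots> = sweedler MCC (comult C c) (\<lambda>c1 c2. sweedler MCC (coaction A a) (\<lambda>a0 a1.
      pt2 (cofree_dot (pt n c1) a0) (dotC (aut C c2) a1)))"
    by (rule sweedler_cong Typing mc n a | simp add: cofree_dot_ptens n)+
  also have "\<dots> = sweedler MCC (sweedler MCC (comult C c) (\<lambda>c1 c2. pt2 (pt n c1) (aut C c2))) (\<lambda>s c.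
      sweedler MCC (coaction A a) (\<lambda>a0 a1. pt2 (cofree_dot s a0) (dotC c a1)))"
    by (rule sweedler_sweedler_ptens[symmetric] Typing mc n a | assumption)+
  also have "sweedler MCC (comult C c) (\<lambda>c1 c2. pt2 (pt n c1) (aut C c2)) = cofree_coact (pt m c)"
    by (simp add: cofree_coact_ptens mc n_def)
  finally show "cofree_coact (cofree_dot (pt m c) a) = sweedler MCC (cofree_coact (pt m c)) (\<lambda>s c.
      sweedler MCC (coaction A a) (\<lambda>a0 a1. pt2 (cofree_dot s a0) (dotC c a1)))" .
qed (rule Typing assms | assumption)+

lemma cofree_doi_mod: "is_doi_mod k A C H cofree"
  unfolding is_doi_mod_def
proof (intro conjI ballI cofree_module cofree_comodule)
  fix t a assume "t \<in> elts cofree" and a: "a \<in> elts A"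
  then have t: "t \<in> carrier MC" by simp
  have "sweedler MCC (cofree_coact t) (\<lambda>s c. sweedler MCC (coaction A a) (\<lambda>a0 a1. pt2 (cofree_dot s a0) (dotC c a1))) =
    sweedler MCC (cofree_coact t) (\<lambda>s c. sweedler MCC (coaction A a) (\<lambda>a0 a1.
      pt2 (dot k cofree A (act cofree) s a0) (dotC c a1)))"
    by (rule sweedler_cong Typing t a | simp add: dot_cofree del: cofree_simps(3))+
  then show "coact cofree (dot k cofree A (act cofree) t a) = sweedler (und (tens k cofree C)) (coact cofree t)
      (\<lambda>m0 m1. sweedler (und (tens k cofree C)) (coaction A a)
        (\<lambda>a0 a1. ptens k (und cofree) (und C) (dot k cofree A (act cofree) m0 a0) (dotC m1 a1)))"
    using cofree_compatible[OF t a] t a by (simp add: dot_cofree del: cofree_simps(3))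
qed

section \<open>The counit M \<otimes> C \<rightarrow> M of the adjunction\<close>

lemma cofree_counit_aut:
  assumes "t \<in> carrier MC"
  shows "aut M (cofree_counit t) = cofree_counit (aut (tens k M C) t)"
proof (rule tensor_module_ext[of k "und M" "und C" "und M" "\<lambda>t. aut M (cofree_counit t)"
    "\<lambda>t. cofree_counit (aut (tens k M C) t)"])
  fix m c assume mc: "m \<in> elts M" "c \<in> elts C"
  have "aut M (counit C c \<odot>\<^bsub>und M\<^esub> aut M m) = counit C c \<odot>\<^bsub>und M\<^esub> aut M (aut M m)"
    by (rule linear_map_smult[where f = "aut M"] Typing mc | assumption)+
  then show "aut M (cofree_counit (pt m c)) = cofree_counit (aut (tens k M C) (pt m c))"
    by (simp add: mc cofree_counit_ptens autMC closed M_closed counit_aut)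
qed (rule Typing assms | assumption)+

text \<open>From \<epsilon>(c \<cdot> a1) = \<epsilon>(c) \<epsilon>(a1), the counit law of the
  coaction of A leaves \<beta>^-1(a). The \<beta> produced by \<mu>(m \<cdot> a0) = \<mu>(m) \<cdot>
  \<beta>(a0) cancels it.\<close>

lemma cofree_counit_dot:
  assumes "t \<in> carrier MC" and a: "a \<in> elts A"
  shows "cofree_counit (cofree_dot t a) = dotM (cofree_counit t) a"
proof (rule tensor_module_ext[of k "und M" "und C" "und M" "\<lambda>t. cofree_counit (cofree_dot t a)"
    "\<lambda>t. dotM (cofree_counit t) a"])
  interpret module k "und M" by (rule M_mod)
  fix m c assume mc: "m \<in> elts M" "c \<in> elts C"
  have "cofree_counit (cofree_dot (pt m c) a) =
      cofree_counit (sweedler MC (coaction A a) (\<lambda>a0 a1. pt (dotM m a0) (dotC c a1)))"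
    by (simp add: cofree_dot_ptens mc a)
  also have "\<dots> = sweedler (und M) (coaction A a) (\<lambda>a0 a1. cofree_counit (pt (dotM m a0) (dotC c a1)))"
    by (rule linear_map_sweedler[where f = cofree_counit] Typing mc a | assumption)+
  also have "\<dots> = sweedler (und M) (coaction A a)
      (\<lambda>a0 a1. bi_counit H a1 \<odot>\<^bsub>und M\<^esub> (counit C c \<odot>\<^bsub>und M\<^esub> dotM (aut M m) (aut A a0)))"
    by (rule sweedler_cong Typing mc a
        | simp add: mc cofree_counit_ptens closed M_closed counit_dot dotM_simps smult_assoc1[symmetric] R.m_comm)+
  also have "\<dots> = counit C c \<odot>\<^bsub>und M\<^esub> dotM (aut M m) (aut A (aut_inv A a))"
    by (rule coaction_counit[where f = "\<lambda>x. counit C c \<odot>\<^bsub>und M\<^esub> dotM (aut M m) (aut A x)"] Typing mc a | assumption)+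
  also have "\<dots> = dotM (counit C c \<odot>\<^bsub>und M\<^esub> aut M m) (aut A (aut_inv A a))"
    by (rule linear_map_smult[where f = "\<lambda>x. dotM x (aut A (aut_inv A a))", symmetric] Typing mc a | assumption)+
  finally show "cofree_counit (cofree_dot (pt m c) a) = dotM (cofree_counit (pt m c)) a"
    by (simp add: mc cofree_counit_ptens aut_aut_inv[OF A_obj] a)
qed (rule Typing assms | assumption)+

text \<open>A triangle identity. On the first leg \<mu> cancels \<mu>^-1; on the other, the left
  counit law gives \<gamma>^-1(c), which the \<gamma> of the coaction undoes.\<close>

lemma cofree_counit_coact:
  assumes "t \<in> carrier MC"
  shows "sweedler MC (cofree_coact t) (\<lambda>s c. pt (cofree_counit s) c) = t"
proof (rule tensor_module_ext[of k "und M" "und C" MC "\<lambda>t. sweedler MC (cofree_coact t) (\<lambda>s c. pt (cofree_counit s) c)"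
    "\<lambda>t. t"])
  fix m c assume mc: "m \<in> elts M" "c \<in> elts C"
  have "sweedler MC (cofree_coact (pt m c)) (\<lambda>s c. pt (cofree_counit s) c) =
      sweedler MC (comult C c) (\<lambda>c1 c2. pt (cofree_counit (pt (aut_inv M m) c1)) (aut C c2))"
    unfolding cofree_coact_ptens[OF mc] by (rule sweedler_sweedler_ptens Typing mc | assumption)+
  also have "\<dots> = sweedler MC (comult C c) (\<lambda>c1 c2. pt (counit C c1 \<odot>\<^bsub>und M\<^esub> m) (aut C c2))"
    by (rule sweedler_cong Typing mc | simp add: mc cofree_counit_ptens M_closed autM)+
  also have "\<dots> = sweedler MC (comult C c) (\<lambda>c1 c2. counit C c1 \<odot>\<^bsub>MC\<^esub> pt m (aut C c2))"
    by (rule sweedler_cong linear_map_smult[where f = "\<lambda>x. pt x (aut C y)" for y] Typing mc | assumption)+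
  also have "\<dots> = pt m (aut C (aut_inv C c))"
    by (rule comult_counit_left Typing mc | assumption)+
  finally show "sweedler MC (cofree_coact (pt m c)) (\<lambda>s c. pt (cofree_counit s) c) = pt m c"
    by (simp add: autC mc)
qed (rule Typing assms | assumption)+

lemma cofree_counit_mor: "hom_obj_mor k cofree M (restrict cofree_counit (carrier MC))"
  using linear_map_cong[OF cofree_counit_typing(1)[OF linear_map_id], of "restrict cofree_counit (carrier MC)"]
  by (simp add: hom_obj_mor_def Typing cofree_counit_aut)

lemma cofree_counit_a_linear: "a_linear k A cofree M (restrict cofree_counit (carrier MC))"
  by (simp add: a_linear_def dot_cofree Typing cofree_counit_dot del: cofree_simps(3))

end

section \<open>Factorisation of A-linear maps through M \<otimes> C\<close>

locale doi_cofree_lift = doi_cofree k H A C M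
  for k :: "'k ring"
    and H :: "('k, 'u) hom_bialg" and A :: "('k, 'u) comodule_alg" and C :: "('k, 'u) module_coalg"
    and M :: "('k, 'u) hom_mod" +
  fixes X :: "('k, 'u) doi_mod" and f :: "'u univ \<Rightarrow> 'u univ"
  assumes X: "is_doi_mod k A C H X" and f_mor: "hom_obj_mor k X M f" and f_lin: "a_linear k A X M f"
begin

abbreviation dotX where "dotX \<equiv> dot k X A (act X)"

lemmas X_module = is_doi_mod_hom_module[OF X]
lemmas X_comodule = is_doi_mod_hom_comodule[OF X]
lemmas X_obj = is_doi_mod_obj[OF X]
lemmas X_mod = is_hom_obj_module[OF X_obj]

lemma f_linear: "linear_map k (und X) (und M) f"
  using f_mor by (simp add: hom_obj_mor_def)

lemma f_aut: "x \<in> elts X \<Longrightarrow> aut M (f x) = f (aut X x)"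
  using f_mor by (simp add: hom_obj_mor_def)

lemmas f_closed = hom_obj_mor_closed[OF f_mor]

lemmas X_typing = X_mod aut_closed[OF X_obj] aut_inv_closed[OF X_obj] is_hom_module_closed[OF X_module A_obj]
  aut_linear[OF X_obj] aut_inv_linear[OF X_obj]
  linear_map_comp[OF hom_coaction_linear[OF X_comodule]] linear_map_closed[OF hom_coaction_linear[OF X_comodule]]
  linear_map_comp[OF f_linear] f_closed

lemma f_aut_inv: "x \<in> elts X \<Longrightarrow> aut_inv M (f x) = f (aut_inv X x)"
  using f_aut[of "aut_inv X x"] by (metis X_typing(3) aut_aut_inv[OF X_obj] autM(2) f_closed)

text \<open>f \<otimes> C after the coaction of X, the coaction itself being the unit of the
  adjunction.\<close>

definition lift where
  "lift x = sweedler MC (coact X x) (\<lambda>x0 x1. pt (f x0) x1)"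

lemma lift_typing:
  "linear_map k Z (und X) g \<Longrightarrow> linear_map k Z MC (\<lambda>z. lift (g z))"
  "x \<in> elts X \<Longrightarrow> lift x \<in> carrier MC"
  unfolding lift_def by (rule Typing X_typing | assumption)+

lemmas Lift_typing = Typing X_typing lift_typing

lemma lift_aut:
  assumes x: "x \<in> elts X"
  shows "aut (tens k M C) (lift x) = lift (aut X x)"
proof -
  have "aut (tens k M C) (lift x) = sweedler MC (coact X x) (\<lambda>x0 x1. aut (tens k M C) (pt (f x0) x1))"
    unfolding lift_def by (rule linear_map_sweedler[where f = "aut (tens k M C)"] Lift_typing x | assumption)+
  also have "\<dots> = sweedler MC (coact X x) (\<lambda>x0 x1. pt (f (aut X x0)) (aut C x1))"
    by (rule sweedler_cong Lift_typing x | simp add: autMC f_closed f_aut)+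
  also have "\<dots> = lift (aut X x)"
    unfolding lift_def
    by (rule hom_comodule_aut[OF X_comodule C_obj x, symmetric] Lift_typing | assumption)+
  finally show ?thesis .
qed

text \<open>The Doi compatibility condition says precisely that the coaction of X is A-linear for
  the diagonal action on X \<otimes> C; A-linearity of f carries this over to M \<otimes> C.\<close>

lemma lift_dot:
  assumes x: "x \<in> elts X" and a: "a \<in> elts A"
  shows "lift (dotX x a) = cofree_dot (lift x) a"
proof -
  have "coact X (dotX x a) = sweedler (tensor_module k (und X) (und C)) (coact X x) (\<lambda>x0 x1.
      sweedler (tensor_module k (und X) (und C)) (coaction A a) (\<lambda>a0 a1.
        ptens k (und X) (und C) (dotX x0 a0) (dotC x1 a1)))"
    using X x a by (simp add: is_doi_mod_def)
  then have "lift (dotX x a) = sweedler MC (sweedler (tensor_module k (und X) (und C)) (coact X x) (\<lambda>x0 x1.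
      sweedler (tensor_module k (und X) (und C)) (coaction A a) (\<lambda>a0 a1.
        ptens k (und X) (und C) (dotX x0 a0) (dotC x1 a1)))) (\<lambda>x0 x1. pt (f x0) x1)"
    by (simp add: lift_def)
  also have "\<dots> = sweedler MC (coact X x) (\<lambda>x0 x1. sweedler MC (coaction A a) (\<lambda>a0 a1. pt (f (dotX x0 a0)) (dotC x1 a1)))"
    by (rule sweedler_sweedler2_ptens Lift_typing x a | assumption)+
  also have "\<dots> = sweedler MC (coact X x) (\<lambda>x0 x1. cofree_dot (pt (f x0) x1) a)"
    by (rule sweedler_cong[OF linear_map_closed[OF hom_coaction_linear[OF X_comodule]]]
        sweedler_cong[OF linear_map_closed[OF coaction_linear]] Lift_typing x a
      | simp add: cofree_dot_ptens f_closed a f_lin[unfolded a_linear_def, rule_format])+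
  also have "\<dots> = cofree_dot (lift x) a"
    unfolding lift_def
    by (rule linear_map_sweedler[where f = "\<lambda>t. cofree_dot t a", symmetric] Lift_typing x a | assumption)+
  finally show ?thesis .
qed

text \<open>Since f commutes with the automorphisms, this is coassociativity of X: its inverse twist
  on x0 is the \<mu>^-1 of \<open>cofree_coact\<close>, and its \<gamma>^-1 on x1 is cancelled by
  the \<gamma> there.\<close>

lemma lift_coact:
  assumes x: "x \<in> elts X"
  shows "cofree_coact (lift x) = sweedler MCC (coact X x) (\<lambda>x0 x1. pt2 (lift x0) x1)"
proof -
  have "cofree_coact (lift x) = sweedler MCC (coact X x) (\<lambda>x0 x1. cofree_coact (pt (f x0) x1))"
    unfolding lift_def by (rule linear_map_sweedler[where f = cofree_coact] Lift_typing x | assumption)+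
  also have "\<dots> = sweedler MCC (coact X x) (\<lambda>x0 x1. sweedler MCC (comult C x1)
      (\<lambda>y z. pt2 (pt (f (aut_inv X x0)) y) (aut C z)))"
    by (rule sweedler_cong Lift_typing x | simp add: cofree_coact_ptens f_closed f_aut_inv)+
  also have "\<dots> = sweedler MCC (coact X x) (\<lambda>x0 x1. sweedler MCC (coact X x0)
      (\<lambda>y z. pt2 (pt (f y) z) (aut C (aut_inv C x1))))"
    by (rule hom_comodule_coassoc[OF X_comodule C_coalg x, symmetric,
          where T = "\<lambda>x y z. pt2 (pt (f x) y) (aut C z)"] Lift_typing | assumption)+
  also have "\<dots> = sweedler MCC (coact X x) (\<lambda>x0 x1. sweedler MCC (coact X x0) (\<lambda>y z. pt2 (pt (f y) z) x1))"
    by (rule sweedler_cong Lift_typing x | simp add: autC)+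
  also have "\<dots> = sweedler MCC (coact X x) (\<lambda>x0 x1. pt2 (lift x0) x1)"
    unfolding lift_def
    by (rule linear_map_sweedler[where f = "\<lambda>s. pt2 s v" for v, symmetric] sweedler_cong Lift_typing x | assumption)+
  finally show ?thesis .
qed

text \<open>The factor \<mu> of the counit passes through f to x0 and cancels the inverse
  automorphism left by the counit axiom of X.\<close>

lemma cofree_counit_lift:
  assumes x: "x \<in> elts X"
  shows "cofree_counit (lift x) = f x"
proof -
  have "cofree_counit (lift x) = sweedler (und M) (coact X x) (\<lambda>x0 x1. cofree_counit (pt (f x0) x1))"
    unfolding lift_def by (rule linear_map_sweedler[where f = cofree_counit] Lift_typing x | assumption)+
  also have "\<dots> = sweedler (und M) (coact X x) (\<lambda>x0 x1. counit C x1 \<odot>\<^bsub>und M\<^esub> f (aut X x0))"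
    by (rule sweedler_cong Lift_typing x | simp add: cofree_counit_ptens f_closed f_aut)+
  also have "\<dots> = f (aut X (aut_inv X x))"
    by (rule hom_comodule_counit[OF X_comodule C_coalg x] Lift_typing | assumption)+
  finally show ?thesis by (simp add: aut_aut_inv[OF X_obj] x)
qed

text \<open>By \<open>cofree_counit_coact\<close>, g(x) is recovered from its coaction. Colinearity
  rewrites that coaction as g(x0) \<otimes> x1, and the counit turns g(x0) into f(x0).\<close>

lemma lift_unique:
  assumes g: "hom_obj_mor k X cofree g" "c_colinear k C X cofree g"
    and eq: "\<And>x. x \<in> elts X \<Longrightarrow> cofree_counit (g x) = f x" and x: "x \<in> elts X"
  shows "g x = lift x"
proof -
  have g_closed: "g x \<in> carrier MC" if "x \<in> elts X" for x
    using hom_obj_mor_closed[OF g(1) that] by simp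
  have "lift x = sweedler MC (coact X x) (\<lambda>x0 x1. pt (cofree_counit (g x0)) x1)"
    unfolding lift_def by (rule sweedler_cong Lift_typing x | simp add: eq)+
  also have "\<dots> = sweedler MC (sweedler MCC (coact X x) (\<lambda>x0 x1. pt2 (g x0) x1)) (\<lambda>s c. pt (cofree_counit s) c)"
    by (rule sweedler_sweedler_ptens[symmetric] Lift_typing x g_closed | assumption)+
  also have "sweedler MCC (coact X x) (\<lambda>x0 x1. pt2 (g x0) x1) = cofree_coact (g x)"
    using g(2) x by (simp add: c_colinear_def)
  finally show ?thesis
    by (simp add: cofree_counit_coact g_closed x)
qed

lemma lift_mor:
  "hom_obj_mor k X cofree (restrict lift (elts X))"
  "a_linear k A X cofree (restrict lift (elts X))"
  "c_colinear k C X cofree (restrict lift (elts X))"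
proof -
  show "hom_obj_mor k X cofree (restrict lift (elts X))"
    using linear_map_cong[OF lift_typing(1)[OF linear_map_id] X_mod, of "restrict lift (elts X)"]
    by (simp add: hom_obj_mor_def X_typing lift_aut)
  show "a_linear k A X cofree (restrict lift (elts X))"
    by (simp add: a_linear_def X_typing dot_cofree lift_typing lift_dot del: cofree_simps(3))
  have "sweedler MCC (coact X x) (\<lambda>x0 x1. pt2 (lift x0) x1) =
      sweedler MCC (coact X x) (\<lambda>x0 x1. pt2 (restrict lift (elts X) x0) x1)" if x: "x \<in> elts X" for x
    by (rule sweedler_cong Lift_typing x | simp)+
  then show "c_colinear k C X cofree (restrict lift (elts X))"
    by (simp add: c_colinear_def lift_coact)
qed

lemma lift_couniversal:
  "\<exists>!g. (hom_obj_mor k X cofree g \<and> a_linear k A X cofree g \<and> c_colinear k C X cofree g) \<and>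
    compose (elts X) (restrict cofree_counit (carrier MC)) g = f"
proof (rule ex1I)
  \<comment> \<open>The factorisation is an equality of functions, so f must also agree with the
    composite outside the carrier of X.\<close>
  have ext: "f \<in> extensional (elts X)"
    using f_mor by (simp add: hom_obj_mor_def)
  have "compose (elts X) (restrict cofree_counit (carrier MC)) (restrict lift (elts X)) = f"
    using ext by (auto simp: compose_def lift_typing cofree_counit_lift extensional_def)
  with lift_mor show "(hom_obj_mor k X cofree (restrict lift (elts X)) \<and>
      a_linear k A X cofree (restrict lift (elts X)) \<and> c_colinear k C X cofree (restrict lift (elts X))) \<and>
    compose (elts X) (restrict cofree_counit (carrier MC)) (restrict lift (elts X)) = f"
    by blast
next
  fix g
  assume g: "(hom_obj_mor k X cofree g \<and> a_linear k A X cofree g \<and> c_colinear k C X cofree g) \<and>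
    compose (elts X) (restrict cofree_counit (carrier MC)) g = f"
  then have mor: "hom_obj_mor k X cofree g" by blast
  have "cofree_counit (g x) = f x" if x: "x \<in> elts X" for x
    using g hom_obj_mor_closed[OF mor x] x by (auto simp: compose_def)
  then have "g x = lift x" if "x \<in> elts X" for x
    using g that by (intro lift_unique) auto
  then show "g = restrict lift (elts X)"
    using mor by (auto simp: hom_obj_mor_def extensional_def)
qed

end

section \<open>Assembly of the adjunction from the couniversal arrows\<close>

theorem proposition3p4:
  fixes k :: "'k ring"
    and H :: "('k, 'u) hom_bialg"
    and A :: "('k, 'u) comodule_alg"
    and C :: "('k, 'u) module_coalg"
  assumes "cring k"
    and "doi_hom_hopf_datum k H A C"
  shows "\<exists>G.
    is_right_adjoint (doi_mod_cat k H A C) (hom_mod_cat k A) forget G \<and>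
    (\<forall>M\<in>Ob (hom_mod_cat k A).
      hom_obj.truncate (obj_map G M) = tens k M C \<and>
      (\<forall>m\<in>elts M. \<forall>c\<in>elts C.
        (\<forall>a\<in>elts A.
          dot k (obj_map G M) A (act (obj_map G M)) (m \<otimes>[M,k,C] c) a =
            sweedler (und (tens k M C)) (coaction A a) (\<lambda>a0 a1.
              dot k M A (act M) m a0 \<otimes>[M,k,C] dot k C H (action C) c a1)) \<and>
        coact (obj_map G M) (m \<otimes>[M,k,C] c) =
          sweedler (und (tens k (tens k M C) C)) (comult C c) (\<lambda>c1 c2.
            (aut_inv M m \<otimes>[M,k,C] c1) \<otimes>[tens k M C,k,C] aut C c2)))"
proof -
  interpret doi_datum k H A C by unfold_locales (rule assms(2))
  let ?C = "doi_mod_cat k H A C" and ?D = "hom_mod_cat k A :: (('k, 'u) hom_mod, _) cat"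
  let ?G = "doi_cofree.cofree k H A C"
  \<comment> \<open>Outside the locale the constructions take M as an argument and so form families
    indexed by objects. The counit is restricted to the carrier because Hom-sets contain only
    extensional functions.\<close>
  let ?e = "\<lambda>M. restrict (doi_cofree.cofree_counit C M) (elts (?G M))"
  have cofree: "doi_cofree k H A C M" if "M \<in> Ob ?D" for M
    using that by unfold_locales (simp add: hom_mod_cat_def)
  \<comment> \<open>The equation for \<open>obj_map G\<close> is carried along with adjointness
    because the formulas for the action and the coaction are read off from it.\<close>
  have "\<exists>G. is_right_adjoint ?C ?D forget G \<and> obj_map G = ?G"
  proof (rule is_right_adjoint_couniversal[where e = ?e])
    show "is_category ?C" by (rule is_category_doi_mod_cat[OF A_alg C_coalg])
    show "is_category ?D" by (rule is_category_hom_mod_cat[OF A_alg])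
    show "is_functor ?C ?D forget" by (rule is_functor_forget)
  next
    fix M :: "('k, 'u) hom_mod" assume "M \<in> Ob ?D"
    then interpret doi_cofree k H A C M by (rule cofree)
    show "?G M \<in> Ob ?C"
      using cofree_doi_mod by (simp add: doi_mod_cat_def)
    show "?e M \<in> Hom ?D (obj_map forget (?G M)) M"
      using cofree_counit_mor cofree_counit_a_linear by (simp add: hom_mod_cat_def forget_def)
  next
    fix X :: "('k, 'u) doi_mod" and M :: "('k, 'u) hom_mod" and f
    assume X: "X \<in> Ob ?C" and M: "M \<in> Ob ?D" and f: "f \<in> Hom ?D (obj_map forget X) M"
    interpret doi_cofree k H A C M by (rule cofree[OF M])
    interpret doi_cofree_lift k H A C M X f
      using X f by unfold_locales (simp_all add: doi_mod_cat_def hom_mod_cat_def forget_def)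
    show "\<exists>!g. g \<in> Hom ?C X (?G M) \<and>
        Comp ?D (obj_map forget X) (obj_map forget (?G M)) M (?e M) (arr_map forget X (?G M) g) = f"
      using lift_couniversal by (simp add: doi_mod_cat_def hom_mod_cat_def forget_def)
  qed
  then obtain G where G: "is_right_adjoint ?C ?D forget G" "obj_map G = ?G" by blast
  show ?thesis
  proof (intro exI[of _ G] conjI ballI G(1))
    fix M :: "('k, 'u) hom_mod" assume "M \<in> Ob ?D"
    then interpret doi_cofree k H A C M by (rule cofree)
    show "hom_obj.truncate (obj_map G M) = tens k M C"
      by (simp add: G(2))
    fix m c assume mc: "m \<in> elts M" "c \<in> elts C"
    show "coact (obj_map G M) (m \<otimes>[M,k,C] c) = sweedler (und (tens k (tens k M C) C)) (comult C c)
        (\<lambda>c1 c2. (aut_inv M m \<otimes>[M,k,C] c1) \<otimes>[tens k M C,k,C] aut C c2)"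
      by (simp add: G(2) cofree_coact_ptens mc)
    fix a assume a: "a \<in> elts A"
    have "m \<otimes>[M,k,C] c \<in> carrier MC" by (rule Typing mc)+
    then show "dot k (obj_map G M) A (act (obj_map G M)) (m \<otimes>[M,k,C] c) a =
        sweedler (und (tens k M C)) (coaction A a) (\<lambda>a0 a1. dotM m a0 \<otimes>[M,k,C] dotC c a1)"
      unfolding G(2) by (simp add: dot_cofree cofree_dot_ptens mc a del: cofree_simps(3))
  qed
qed

end
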